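(* Let $V$ be a valuation domain with quotient field $K$ and valuation $v$, let $\overline{K}$ be an algebraic closure of $K$, and let $U$ be a fixed extension of $V$ to $\overline{K}$, with valuation $u$. Let $(\alpha,\delta),(\alpha',\delta')\in\overline{K}\times\Gamma_{\overline{v}}$. Then the following are equivalent: (1) $U_{\alpha,\delta}\cap K(X)=U_{\alpha',\delta'}\cap K(X)$; (2) $\sigma(U_{\alpha,\delta})=U_{\alpha',\delta'}$ for some $\sigma\in\mathcal{D}(U)$; (3) $\delta=\delta'$ and $u(\sigma(\alpha)-\alpha')\ge\delta$ for some $\sigma\in\mathcal{D}(U)$. In particular, for the residually transcendental extension $W=U_{\alpha,\delta}\cap K(X)$ of $V$ to $K(X)$, the set of extensions of $W$ to $\overline{K}(X)$ lying above $U$ equals $\{U_{\sigma(\alpha),\delta}:\sigma\in\mathcal{D}(U)\}$.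
   Context: $\Gamma_v$ is the value group of $v$ and $\Gamma_{\overline{v}}=\Gamma_v\otimes_{\mathbb{Z}}\mathbb{Q}$ its divisible hull (which is the value group of $u$). For $(\alpha,\delta)\in\overline{K}\times\Gamma_{\overline{v}}$, the monomial valuation $u_{\alpha,\delta}$ on $\overline{K}(X)$ is defined on polynomials by $u_{\alpha,\delta}\big(\sum_{i}a_i(X-\alpha)^i\big)=\min_i\{u(a_i)+i\delta\}$ ($a_i\in\overline{K}$) and extended to $\overline{K}(X)$; $U_{\alpha,\delta}$ is its valuation domain. $G_K=\mathrm{Gal}(\overline{K}/K)$ acts on $\overline{K}(X)$ via coefficients, and $\mathcal{D}(U)=\{\sigma\in G_K:\sigma(U)=U\}$ is the decomposition group of $U$. An extension $W$ of $V$ to $K(X)$ (a valuation domain of $K(X)$ with $W\cap K=V$) is residually transcendental if its residue field is transcendental over that of $V$. *)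

theory Defs
  imports "HOL-Computational_Algebra.Polynomial" "HOL-Computational_Algebra.Fraction_Field"
begin

text \<open>K is a subfield of the field 'k (which plays the role of the algebraic closure).\<close>
definition is_subfield :: "'k::field set \<Rightarrow> bool" where
  "is_subfield K \<longleftrightarrow> 0 \<in> K \<and> 1 \<in> K \<and>
     (\<forall>x\<in>K. \<forall>y\<in>K. x + y \<in> K \<and> x - y \<in> K \<and> x * y \<in> K) \<and>
     (\<forall>x\<in>K. inverse x \<in> K)"

definition alg_closed_type :: "'k::field itself \<Rightarrow> bool" where
  "alg_closed_type _ \<longleftrightarrow> (\<forall>p :: 'k poly. degree p \<ge> 1 \<longrightarrow> (\<exists>x. poly p x = 0))"

definition algebraic_over :: "'k::field set \<Rightarrow> bool" where
  "algebraic_over K \<longleftrightarrow> (\<forall>x. \<exists>p :: 'k poly. p \<noteq> 0 \<and> (\<forall>i. coeff p i \<in> K) \<and> poly p x = 0)"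

text \<open>Krull valuation on 'k, given by its values on nonzero elements (u 0 = infinity is
  not represented; the value at 0 is irrelevant).\<close>
definition is_valuation :: "('k::field \<Rightarrow> 'g::linordered_ab_group_add) \<Rightarrow> bool" where
  "is_valuation u \<longleftrightarrow>
     (\<forall>x y. x \<noteq> 0 \<longrightarrow> y \<noteq> 0 \<longrightarrow> u (x * y) = u x + u y) \<and>
     (\<forall>x y. x \<noteq> 0 \<longrightarrow> y \<noteq> 0 \<longrightarrow> x + y \<noteq> 0 \<longrightarrow> min (u x) (u y) \<le> u (x + y))"

definition val_ring :: "('k::field \<Rightarrow> 'g::linordered_ab_group_add) \<Rightarrow> 'k set" where
  "val_ring u = {x. x = 0 \<or> 0 \<le> u x}"

text \<open>Value group of u (= divisible hull of the value group of v).\<close>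
definition value_group :: "('k::field \<Rightarrow> 'g::linordered_ab_group_add) \<Rightarrow> 'g set" where
  "value_group u = u ` (UNIV - {0})"

definition gmul :: "nat \<Rightarrow> 'g::linordered_ab_group_add \<Rightarrow> 'g" where
  "gmul n d = ((+) d ^^ n) 0"

text \<open>Monomial valuation on nonzero polynomials:
  u_{alpha,delta}(sum a_i (X - alpha)^i) = min (u a_i + i delta).\<close>
definition mono_val :: "('k::field \<Rightarrow> 'g::linordered_ab_group_add) \<Rightarrow> 'k \<Rightarrow> 'g \<Rightarrow> 'k poly \<Rightarrow> 'g" where
  "mono_val u \<alpha> \<delta> p =
     Min {u (coeff (pcompose p [:\<alpha>, 1:]) i) + gmul i \<delta> | i. coeff (pcompose p [:\<alpha>, 1:]) i \<noteq> 0}"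

text \<open>The valuation domain U_{alpha,delta} of \<overline>K(X) of the extension of mono_val to the
  rational function field (f = p/q lies in it iff its value w(p) - w(q) is >= 0).\<close>
definition U_ad :: "('k::field \<Rightarrow> 'g::linordered_ab_group_add) \<Rightarrow> 'k \<Rightarrow> 'g \<Rightarrow> 'k poly fract set" where
  "U_ad u \<alpha> \<delta> = {f. \<exists>p q. q \<noteq> 0 \<and> f = Fract p q \<and> (p = 0 \<or> mono_val u \<alpha> \<delta> q \<le> mono_val u \<alpha> \<delta> p)}"

definition ratfun_over :: "'k::field set \<Rightarrow> 'k poly fract set" where
  "ratfun_over K = {f. \<exists>p q. q \<noteq> 0 \<and> f = Fract p q \<and> (\<forall>i. coeff p i \<in> K) \<and> (\<forall>i. coeff q i \<in> K)}"

definition const_fr :: "'k::field \<Rightarrow> 'k poly fract" where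
  "const_fr c = Fract [:c:] 1"

definition gal :: "'k::field set \<Rightarrow> ('k \<Rightarrow> 'k) set" where
  "gal K = {\<sigma>. bij \<sigma> \<and> \<sigma> 1 = 1 \<and> (\<forall>x y. \<sigma> (x + y) = \<sigma> x + \<sigma> y \<and> \<sigma> (x * y) = \<sigma> x * \<sigma> y)
              \<and> (\<forall>x\<in>K. \<sigma> x = x)}"

definition gal_img :: "('k::field \<Rightarrow> 'k) \<Rightarrow> 'k poly fract set \<Rightarrow> 'k poly fract set" where
  "gal_img \<sigma> S = {Fract (map_poly \<sigma> p) (map_poly \<sigma> q) | p q. q \<noteq> 0 \<and> Fract p q \<in> S}"

definition decomp_group :: "'k::field set \<Rightarrow> ('k \<Rightarrow> 'g::linordered_ab_group_add) \<Rightarrow> ('k \<Rightarrow> 'k) set" where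
  "decomp_group K u = {\<sigma> \<in> gal K. \<sigma> ` val_ring u = val_ring u}"

definition is_valuation_domain :: "'a::field set \<Rightarrow> bool" where
  "is_valuation_domain R \<longleftrightarrow> 0 \<in> R \<and> 1 \<in> R \<and>
     (\<forall>x\<in>R. \<forall>y\<in>R. x + y \<in> R \<and> x - y \<in> R \<and> x * y \<in> R) \<and>
     (\<forall>x. x \<noteq> 0 \<longrightarrow> x \<in> R \<or> inverse x \<in> R)"

end

theory Submission
  imports Defs
begin

text \<open>
  Let \<open>R\<close> be an extension to \<open>K\<^sup>a(X)\<close> of \<open>U_{\<alpha>,\<delta>} \<inter> K(X)\<close> above \<open>U\<close>. Since \<open>K\<^sup>a(X)\<close> is algebraic over \<open>K(X)\<close>
  and \<open>K\<^sup>a\<close> has all roots, \<open>R\<close> comes from a valuation \<open>w\<close> with values in the value group of \<open>u\<close>.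
  A valuation of polynomials is determined by its values on the \<open>X - b\<close>, and it is
  monomial with centre \<open>\<beta>\<close> as soon as \<open>w (X - \<beta>)\<close> is maximal among them. The maximum is attained at a
  conjugate \<open>\<beta>\<close> of \<open>\<alpha>\<close>: otherwise some \<open>b\<close> is closer to \<open>X\<close> than all conjugates, and then the
  minimal polynomial \<open>f\<close> of \<open>\<alpha>\<close> has, up to powers and scaling, the algebraic residue of \<open>f(b)\<close>, although its
  residue is transcendental. If \<open>\<alpha>\<close> has least degree over \<open>K\<close> in its ball of radius \<open>\<delta>\<close>, then
  \<open>u (p(\<alpha>)) = w(p) = u (p(\<beta>))\<close> for all \<open>p\<close> over \<open>K\<close> of smaller degree, so \<open>\<alpha> \<mapsto> \<beta>\<close> defines a
  \<open>u\<close>-preserving embedding \<open>K(\<alpha>) \<rightarrow> K\<^sup>a\<close>. By Zorn's lemma and the conjugacy of the finitely many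
  extensions of a valuation to a simple algebraic extension, it extends to an element of \<open>\<D>(U)\<close>.
\<close>

section \<open>Valuations and the Gauss lemma\<close>

lemma gmul_0 [simp]: "gmul 0 d = 0"
  by (simp add: gmul_def)

lemma gmul_Suc [simp]: "gmul (Suc n) d = d + gmul n d"
  by (simp add: gmul_def)

lemma gmul_zero_right [simp]: "gmul n 0 = 0"
  by (induction n) auto

lemma gmul_mono: "a \<le> b \<Longrightarrow> gmul n a \<le> gmul n b"
  by (induction n) (auto intro: add_mono)

lemma gmul_strict_mono: "a < b \<Longrightarrow> 0 < n \<Longrightarrow> gmul n a < gmul n b"
  by (cases n) (auto intro!: add_less_le_mono gmul_mono)

text \<open>Ordered groups are torsion-free; this lets values be compared through multiples that
  come from \<open>K\<close>.\<close>

lemma gmul_inject: "0 < n \<Longrightarrow> gmul n a = gmul n b \<longleftrightarrow> a = b"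
  by (metis gmul_strict_mono less_irrefl neqE)

text \<open>Since \<open>u 0\<close> is a junk value, bounds are stated through predicates that read it as infinity.\<close>

definition vge :: "('f::field \<Rightarrow> 'g::linordered_ab_group_add) \<Rightarrow> 'g \<Rightarrow> 'f \<Rightarrow> bool" where
  "vge u g x \<longleftrightarrow> x = 0 \<or> g \<le> u x"

definition vgt :: "('f::field \<Rightarrow> 'g::linordered_ab_group_add) \<Rightarrow> 'g \<Rightarrow> 'f \<Rightarrow> bool" where
  "vgt u g x \<longleftrightarrow> x = 0 \<or> g < u x"

locale valuation =
  fixes u :: "'f::field \<Rightarrow> 'g::linordered_ab_group_add"
  assumes valuation: "is_valuation u"
begin

lemma val_mult: "x \<noteq> 0 \<Longrightarrow> y \<noteq> 0 \<Longrightarrow> u (x * y) = u x + u y"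
  using valuation by (simp add: is_valuation_def)

lemma val_add: "x \<noteq> 0 \<Longrightarrow> y \<noteq> 0 \<Longrightarrow> x + y \<noteq> 0 \<Longrightarrow> min (u x) (u y) \<le> u (x + y)"
  using valuation by (simp add: is_valuation_def)

lemma val_one [simp]: "u 1 = 0"
  using val_mult[of 1 1] by simp

lemma val_minus_one: "u (- 1) = 0"
proof -
  have "u (-1) + u (-1) = 0"
    using val_mult[of "-1" "-1"] by simp
  then show ?thesis
    by simp
qed

lemma val_minus [simp]: "u (- x) = u x"
  using val_mult[of "-1" x] by (cases "x = 0") (auto simp: val_minus_one)

lemma val_minus_commute: "u (x - y) = u (y - x)"
  by (metis minus_diff_eq val_minus)

lemma val_inverse: "x \<noteq> 0 \<Longrightarrow> u (inverse x) = - u x"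
  using val_mult[of x "inverse x"] by (simp add: eq_neg_iff_add_eq_0 add.commute)

lemma val_divide: "x \<noteq> 0 \<Longrightarrow> y \<noteq> 0 \<Longrightarrow> u (x / y) = u x - u y"
  by (simp add: divide_inverse val_mult val_inverse)

lemma val_power: "x \<noteq> 0 \<Longrightarrow> u (x ^ n) = gmul n (u x)"
  by (induction n) (auto simp: val_mult)

lemma vge_add: "vge u g x \<Longrightarrow> vge u g y \<Longrightarrow> vge u g (x + y)"
  using val_add[of x y] by (cases "x = 0"; cases "y = 0"; cases "x + y = 0") (auto simp: vge_def min_le_iff_disj)

lemma vgt_add: "vgt u g x \<Longrightarrow> vgt u g y \<Longrightarrow> vgt u g (x + y)"
  using val_add[of x y] by (cases "x = 0"; cases "y = 0"; cases "x + y = 0") (auto simp: vgt_def min_le_iff_disj)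

lemma vge_minus [simp]: "vge u g (- x) = vge u g x"
  by (simp add: vge_def)

lemma vgt_minus [simp]: "vgt u g (- x) = vgt u g x"
  by (simp add: vgt_def)

lemma vge_diff: "vge u g x \<Longrightarrow> vge u g y \<Longrightarrow> vge u g (x - y)"
  using vge_add[of g x "- y"] by simp

lemma vgt_diff: "vgt u g x \<Longrightarrow> vgt u g y \<Longrightarrow> vgt u g (x - y)"
  using vgt_add[of g x "- y"] by simp

lemma vge_0 [simp]: "vge u g 0" and vgt_0 [simp]: "vgt u g 0"
  by (auto simp: vge_def vgt_def)

lemma vgt_imp_vge: "vgt u g x \<Longrightarrow> vge u g x"
  by (auto simp: vge_def vgt_def)

lemma vge_sum: "(\<And>i. i \<in> S \<Longrightarrow> vge u g (f i)) \<Longrightarrow> vge u g (sum f S)"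
  by (induction S rule: infinite_finite_induct) (auto intro: vge_add)

lemma vgt_sum: "(\<And>i. i \<in> S \<Longrightarrow> vgt u g (f i)) \<Longrightarrow> vgt u g (sum f S)"
  by (induction S rule: infinite_finite_induct) (auto intro: vgt_add)

lemma vge_mult: "vge u g x \<Longrightarrow> vge u h y \<Longrightarrow> vge u (g + h) (x * y)"
  by (cases "x = 0"; cases "y = 0") (auto simp: vge_def val_mult intro: add_mono)

lemma vgt_mult: "vge u g x \<Longrightarrow> vgt u h y \<Longrightarrow> vgt u (g + h) (x * y)"
  by (cases "x = 0"; cases "y = 0") (auto simp: vge_def vgt_def val_mult intro: add_le_less_mono)

text \<open>If \<open>x + y\<close> were zero, \<open>y\<close> would have the same value as
  \<open>x\<close>; the upper bound comes from \<open>x = (x + y) - y\<close>.\<close>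

lemma val_add_eq: "x \<noteq> 0 \<Longrightarrow> vgt u (u x) y \<Longrightarrow> x + y \<noteq> 0 \<and> u (x + y) = u x"
proof (cases "y = 0")
  case False
  assume x: "x \<noteq> 0" and "vgt u (u x) y"
  with False have lt: "u x < u y"
    by (simp add: vgt_def)
  have nz: "x + y \<noteq> 0"
    using lt by (metis add_eq_0_iff less_irrefl val_minus)
  have "min (u (x + y)) (u (- y)) \<le> u (x + y + - y)"
    by (rule val_add) (use nz x False in auto)
  then show ?thesis
    using nz lt val_add[OF x False nz] by (auto simp: min_def split: if_splits)
qed auto

text \<open>A single term of strictly least value would keep \<open>poly p x\<close> nonzero, so two
  terms of different degrees share the least value; the common power of \<open>x\<close> then
  cancels.\<close>

lemma val_torsion:
  assumes "p \<noteq> 0" "poly p x = 0" "x \<noteq> 0"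
  obtains i j where "i < j" "coeff p i \<noteq> 0" "coeff p j \<noteq> 0"
    "gmul (j - i) (u x) = u (coeff p i / coeff p j)"
proof -
  define I where "I = {i. coeff p i \<noteq> 0}"
  define t where "t i = coeff p i * x ^ i" for i
  have fin: "finite I"
    unfolding I_def by (rule finite_subset[of _ "{..degree p}"]) (auto simp: le_degree)
  have ne: "I \<noteq> {}"
    using assms(1) by (auto simp: I_def poly_eq_iff)
  have nz: "t i \<noteq> 0" if "i \<in> I" for i
    using that assms by (simp add: I_def t_def)
  obtain i where i: "i \<in> I" "\<And>j. j \<in> I \<Longrightarrow> u (t i) \<le> u (t j)"
    using ex_min_if_finite[of "u ` t ` I"] fin ne by (auto simp: not_less)
  have "\<exists>j\<in>I - {i}. u (t j) = u (t i)"
  proof (rule ccontr)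
    assume neg: "\<not> ?thesis"
    have "vgt u (u (t i)) (sum t (I - {i}))"
      by (rule vgt_sum) (use neg i in \<open>force simp: vgt_def order.strict_iff_order\<close>)
    then have "t i + sum t (I - {i}) \<noteq> 0"
      using val_add_eq nz i(1) by blast
    then have "sum t I \<noteq> 0"
      using sum.remove[OF fin i(1)] by metis
    moreover have "sum t I = poly p x"
      unfolding poly_altdef t_def
      by (rule sum.mono_neutral_left) (auto simp: I_def le_degree)
    ultimately show False
      using assms by simp
  qed
  then obtain j where j: "j \<in> I" "j \<noteq> i" "u (t j) = u (t i)"
    by auto
  note result = that
  have main: thesis if ij: "a < b" "a \<in> I" "b \<in> I" "u (t a) = u (t b)" for a b
  proof (rule result[OF ij(1)])
    show "coeff p a \<noteq> 0" "coeff p b \<noteq> 0"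
      using ij by (auto simp: I_def)
    have "t b = coeff p b * x ^ a * x ^ (b - a)"
      using ij(1) by (simp add: t_def power_add[symmetric])
    then have "u (t b) = u (coeff p b) + u (x ^ a) + u (x ^ (b - a))"
      using ij assms(3) by (simp add: val_mult I_def)
    moreover have "u (t a) = u (coeff p a) + u (x ^ a)"
      using ij assms(3) by (simp add: val_mult I_def t_def)
    ultimately have "u (coeff p a) = u (coeff p b) + u (x ^ (b - a))"
      using ij(4) by (simp add: algebra_simps)
    then show "gmul (b - a) (u x) = u (coeff p a / coeff p b)"
      using ij assms(3) by (simp add: val_divide I_def val_power algebra_simps)
  qed
  show thesis
    using main[of i j] main[of j i] i j by (cases "i < j") auto
qed

end

section \<open>Gauss and monomial valuations on polynomials\<close>

definition gauss :: "('f::field \<Rightarrow> 'g::linordered_ab_group_add) \<Rightarrow> 'f poly \<Rightarrow> 'g" where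
  "gauss u p = Min {u (coeff p i) | i. coeff p i \<noteq> 0}"

text \<open>Valuations of the polynomial ring that extend \<open>u\<close>. As with
  \<open>u\<close>, the value at zero carries no meaning.\<close>

definition poly_val :: "('f::field \<Rightarrow> 'g::linordered_ab_group_add) \<Rightarrow> ('f poly \<Rightarrow> 'g) \<Rightarrow> bool" where
  "poly_val u w \<longleftrightarrow>
     (\<forall>p q. p \<noteq> 0 \<longrightarrow> q \<noteq> 0 \<longrightarrow> w (p * q) = w p + w q) \<and>
     (\<forall>p q. p \<noteq> 0 \<longrightarrow> q \<noteq> 0 \<longrightarrow> p + q \<noteq> 0 \<longrightarrow> min (w p) (w q) \<le> w (p + q)) \<and>
     (\<forall>c. c \<noteq> 0 \<longrightarrow> w [:c:] = u c)"

context valuation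
begin

lemma
  assumes "p \<noteq> 0"
  shows gauss_attained: "\<exists>i. coeff p i \<noteq> 0 \<and> u (coeff p i) = gauss u p"
    and gauss_le: "vge u (gauss u p) (coeff p i)"
proof -
  let ?S = "{u (coeff p i) | i. coeff p i \<noteq> 0}"
  have "?S \<subseteq> (\<lambda>i. u (coeff p i)) ` {..degree p}"
    by (auto simp: le_degree)
  then have fin: "finite ?S"
    using finite_surj by blast
  have "u (lead_coeff p) \<in> ?S"
    using assms by force
  then have "Min ?S \<in> ?S"
    using fin Min_in by blast
  then show "\<exists>i. coeff p i \<noteq> 0 \<and> u (coeff p i) = gauss u p"
    unfolding gauss_def by force
  show "vge u (gauss u p) (coeff p i)"
    unfolding vge_def gauss_def using Min_le[OF fin] by blast
qed

lemma gauss_ge_iff: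
  assumes "p \<noteq> 0"
  shows "g \<le> gauss u p \<longleftrightarrow> (\<forall>i. vge u g (coeff p i))"
  using gauss_attained[OF assms] gauss_le[OF assms] by (metis order.trans vge_def)

text \<open>Gauss's lemma. Let \<open>i\<close> and \<open>j\<close> be the least indices at which
  the minima are attained: in the coefficient of \<open>p * q\<close> at \<open>i + j\<close>, the
  product of these two coefficients strictly dominates all other summands.\<close>

lemma gauss_mult:
  assumes "p \<noteq> 0" "q \<noteq> 0"
  shows "gauss u (p * q) = gauss u p + gauss u q"
proof (rule antisym)
  have pq: "p * q \<noteq> 0"
    using assms by simp
  show "gauss u p + gauss u q \<le> gauss u (p * q)"
    unfolding gauss_ge_iff[OF pq] coeff_mult
    using gauss_le[OF assms(1)] gauss_le[OF assms(2)] by (auto intro!: vge_sum vge_mult)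
  define P where "P i \<longleftrightarrow> coeff p i \<noteq> 0 \<and> u (coeff p i) = gauss u p" for i
  define Q where "Q i \<longleftrightarrow> coeff q i \<noteq> 0 \<and> u (coeff q i) = gauss u q" for i
  define i where "i = (LEAST i. P i)"
  define j where "j = (LEAST j. Q j)"
  have i: "P i" and lti: "\<And>k. k < i \<Longrightarrow> \<not> P k"
    using gauss_attained[OF assms(1)] LeastI_ex[of P] not_less_Least[of _ P]
    unfolding i_def P_def by blast+
  have j: "Q j" and ltj: "\<And>k. k < j \<Longrightarrow> \<not> Q k"
    using gauss_attained[OF assms(2)] LeastI_ex[of Q] not_less_Least[of _ Q]
    unfolding j_def Q_def by blast+
  let ?t = "\<lambda>k. coeff p k * coeff q (i + j - k)"
  have rest: "vgt u (gauss u p + gauss u q) (sum ?t ({..i + j} - {i}))"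
  proof (rule vgt_sum)
    fix k assume k: "k \<in> {..i + j} - {i}"
    show "vgt u (gauss u p + gauss u q) (?t k)"
    proof (cases "k < i")
      case True
      then have "vgt u (gauss u p) (coeff p k)"
        using lti gauss_le[OF assms(1), of k] by (force simp: P_def vge_def vgt_def)
      then show ?thesis
        using vgt_mult[OF gauss_le[OF assms(2)]] by (metis add.commute mult.commute)
    next
      case False
      then have "vgt u (gauss u q) (coeff q (i + j - k))"
        using k ltj[of "i + j - k"] gauss_le[OF assms(2), of "i + j - k"]
        by (force simp: Q_def vge_def vgt_def)
      then show ?thesis
        using vgt_mult[OF gauss_le[OF assms(1)]] by blast
    qed
  qed
  have lead: "?t i \<noteq> 0" "u (?t i) = gauss u p + gauss u q"
    using i j by (auto simp: P_def Q_def val_mult)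
  have "?t i + sum ?t ({..i + j} - {i}) \<noteq> 0 \<and>
      u (?t i + sum ?t ({..i + j} - {i})) = u (?t i)"
    by (rule val_add_eq[OF lead(1)]) (unfold lead(2), rule rest)
  moreover have "coeff (p * q) (i + j) = ?t i + sum ?t ({..i + j} - {i})"
    unfolding coeff_mult by (rule sum.remove) auto
  ultimately show "gauss u (p * q) \<le> gauss u p + gauss u q"
    using gauss_le[OF pq, of "i + j"] lead(2) unfolding vge_def by metis
qed

lemma gauss_const: "c \<noteq> 0 \<Longrightarrow> gauss u [:c:] = u c"
proof (rule antisym)
  assume c: "c \<noteq> 0"
  then have nz: "[:c:] \<noteq> 0" by simp
  show "gauss u [:c:] \<le> u c"
    using gauss_le[OF nz, of 0] c by (simp add: vge_def)
  show "u c \<le> gauss u [:c:]"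
    unfolding gauss_ge_iff[OF nz] by (auto simp: vge_def coeff_pCons split: nat.split)
qed

lemma poly_val_gauss: "poly_val u (gauss u)"
  unfolding poly_val_def
proof (intro conjI allI impI)
  fix p q :: "'f poly" assume "p \<noteq> 0" "q \<noteq> 0" "p + q \<noteq> 0"
  then show "min (gauss u p) (gauss u q) \<le> gauss u (p + q)"
    unfolding gauss_ge_iff[OF \<open>p + q \<noteq> 0\<close>] coeff_add
    by (intro allI vge_add) (metis gauss_ge_iff min.cobounded1 min.cobounded2)+
qed (auto simp: gauss_mult gauss_const)

lemma poly_val_pcompose:
  assumes w: "poly_val u w" and h: "degree h \<noteq> 0"
  shows "poly_val u (\<lambda>p. w (pcompose p h))"
proof -
  have nz: "pcompose p h \<noteq> 0" if "p \<noteq> 0" for p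
    using that h pcompose_eq_0[of p h] by auto
  show ?thesis
    unfolding poly_val_def
  proof (intro conjI allI impI)
    fix p q :: "'f poly" assume pq: "p \<noteq> 0" "q \<noteq> 0"
    show "w (pcompose (p * q) h) = w (pcompose p h) + w (pcompose q h)"
      using w pq nz by (simp add: pcompose_mult poly_val_def)
    assume "p + q \<noteq> 0"
    then have "pcompose p h + pcompose q h \<noteq> 0"
      using nz[of "p + q"] by (simp add: pcompose_add)
    then show "min (w (pcompose p h)) (w (pcompose q h)) \<le> w (pcompose (p + q) h)"
      using w pq nz unfolding poly_val_def by (simp add: pcompose_add)
  qed (use w in \<open>simp add: poly_val_def\<close>)
qed

text \<open>Substituting \<open>\<alpha> + d X\<close> multiplies the i-th Taylor coefficient at
  \<open>\<alpha>\<close> by \<open>d ^ i\<close>, which adds \<open>gmul i (u d)\<close> to its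
  value. Multiplicativity of \<open>mono_val\<close> thereby reduces to Gauss's lemma.\<close>

lemma mono_val_eq_gauss:
  assumes "d \<noteq> 0"
  shows "mono_val u \<alpha> (u d) p = gauss u (pcompose p [:\<alpha>, d:])"
proof -
  have "[:\<alpha>, d:] = pcompose [:\<alpha>, 1:] [:0, d:]"
    by (simp add: pcompose_pCons)
  then have eq: "pcompose p [:\<alpha>, d:] = pcompose (pcompose p [:\<alpha>, 1:]) [:0, d:]"
    by (simp add: pcompose_assoc)
  have c: "coeff (pcompose p [:\<alpha>, d:]) i = coeff (pcompose p [:\<alpha>, 1:]) i * d ^ i" for i
    unfolding eq by (simp add: coeff_pcompose_linear)
  have "u (coeff (pcompose p [:\<alpha>, d:]) i) = u (coeff (pcompose p [:\<alpha>, 1:]) i) + gmul i (u d)"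
    if "coeff (pcompose p [:\<alpha>, 1:]) i \<noteq> 0" for i
    using that assms by (simp add: c val_mult val_power)
  moreover have "coeff (pcompose p [:\<alpha>, d:]) i \<noteq> 0 \<longleftrightarrow> coeff (pcompose p [:\<alpha>, 1:]) i \<noteq> 0" for i
    using assms by (simp add: c)
  ultimately have "{u (coeff (pcompose p [:\<alpha>, d:]) i) | i. coeff (pcompose p [:\<alpha>, d:]) i \<noteq> 0} =
    {u (coeff (pcompose p [:\<alpha>, 1:]) i) + gmul i (u d) | i. coeff (pcompose p [:\<alpha>, 1:]) i \<noteq> 0}"
    by (metis (no_types, lifting))
  then show ?thesis
    unfolding gauss_def mono_val_def by simp
qed

lemma poly_val_mono_val:
  assumes "\<delta> \<in> value_group u"
  shows "poly_val u (mono_val u \<alpha> \<delta>)"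
proof -
  obtain d where d: "d \<noteq> 0" "\<delta> = u d"
    using assms by (auto simp: value_group_def)
  have "mono_val u \<alpha> \<delta> = (\<lambda>p. gauss u (pcompose p [:\<alpha>, d:]))"
    using d mono_val_eq_gauss by auto
  then show ?thesis
    using poly_val_pcompose[OF poly_val_gauss, of "[:\<alpha>, d:]"] d by simp
qed

lemma gauss_linear:
  assumes "d \<noteq> 0"
  shows "gauss u [:a, d:] = (if a = 0 then u d else min (u d) (u a))"
proof (rule antisym)
  have nz: "[:a, d:] \<noteq> 0" using assms by simp
  show "gauss u [:a, d:] \<le> (if a = 0 then u d else min (u d) (u a))"
    using gauss_le[OF nz, of 0] gauss_le[OF nz, of 1] assms by (auto simp: vge_def)
  show "(if a = 0 then u d else min (u d) (u a)) \<le> gauss u [:a, d:]"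
    unfolding gauss_ge_iff[OF nz] by (auto simp: vge_def coeff_pCons split: nat.split)
qed

lemma mono_val_linear:
  assumes "\<delta> \<in> value_group u"
  shows "mono_val u \<alpha> \<delta> [:- b, 1:] = (if b = \<alpha> then \<delta> else min \<delta> (u (\<alpha> - b)))"
proof -
  obtain d where d: "d \<noteq> 0" "\<delta> = u d"
    using assms by (auto simp: value_group_def)
  have "pcompose [:- b, 1:] [:\<alpha>, d:] = [:\<alpha> - b, d:]"
    by (simp add: pcompose_pCons)
  then show ?thesis
    using d by (auto simp: mono_val_eq_gauss gauss_linear)
qed

end

section \<open>Extending value-preserving partial isomorphisms\<close>

text \<open>An isomorphism between two subrings of a field is represented by its graph, a subring of the
  product of the field with itself; injectivity and functionality are both contained in \<open>zero_iff\<close>.\<close>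

locale ring_graph =
  fixes G :: "('a::field \<times> 'a) set"
  assumes zero: "(0, 0) \<in> G" and one: "(1, 1) \<in> G"
    and add: "(a, a') \<in> G \<Longrightarrow> (b, b') \<in> G \<Longrightarrow> (a + b, a' + b') \<in> G"
    and diff: "(a, a') \<in> G \<Longrightarrow> (b, b') \<in> G \<Longrightarrow> (a - b, a' - b') \<in> G"
    and mult: "(a, a') \<in> G \<Longrightarrow> (b, b') \<in> G \<Longrightarrow> (a * b, a' * b') \<in> G"
    and zero_iff: "(a, a') \<in> G \<Longrightarrow> a = 0 \<longleftrightarrow> a' = 0"

locale field_graph = ring_graph +
  assumes inverse: "(a, a') \<in> G \<Longrightarrow> (inverse a, inverse a') \<in> G"

definition polyrel :: "('a::field \<times> 'a) set \<Rightarrow> 'a poly \<Rightarrow> 'a poly \<Rightarrow> bool" where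
  "polyrel G P Q \<longleftrightarrow> (\<forall>i. (coeff P i, coeff Q i) \<in> G)"

text \<open>The candidate extension of the isomorphism by \<open>y \<mapsto> z\<close>. In general
  it is only a relation; \<open>ring_graph_adjoin\<close> says when it is single-valued and
  injective.\<close>

definition adjoin :: "('a::field \<times> 'a) set \<Rightarrow> 'a \<Rightarrow> 'a \<Rightarrow> ('a \<times> 'a) set" where
  "adjoin G y z = {(poly P y, poly Q z) | P Q. polyrel G P Q}"

definition frac_graph :: "('a::field \<times> 'a) set \<Rightarrow> ('a \<times> 'a) set" where
  "frac_graph G = {(a / b, a' / b') | a a' b b'. (a, a') \<in> G \<and> (b, b') \<in> G \<and> b \<noteq> 0}"

context ring_graph
begin

lemma functional: "(a, b) \<in> G \<Longrightarrow> (a, c) \<in> G \<Longrightarrow> b = c"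
  using diff[of a b a c] zero_iff[of "a - a" "b - c"] by simp

lemma sum: "(\<And>i. i \<in> S \<Longrightarrow> (f i, g i) \<in> G) \<Longrightarrow> (sum f S, sum g S) \<in> G"
  by (induction S rule: infinite_finite_induct) (auto intro: add zero)

lemma polyrel_0 [simp]: "polyrel G 0 0"
  by (simp add: polyrel_def zero)

lemma polyrel_pCons: "(a, b) \<in> G \<Longrightarrow> polyrel G P Q \<Longrightarrow> polyrel G (pCons a P) (pCons b Q)"
  by (auto simp: polyrel_def coeff_pCons split: nat.split)

lemma polyrel_1 [simp]: "polyrel G 1 1"
  using polyrel_pCons[OF one polyrel_0] by (simp add: one_pCons)

lemma polyrel_add: "polyrel G P P' \<Longrightarrow> polyrel G Q Q' \<Longrightarrow> polyrel G (P + Q) (P' + Q')"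
  by (simp add: polyrel_def add)

lemma polyrel_diff: "polyrel G P P' \<Longrightarrow> polyrel G Q Q' \<Longrightarrow> polyrel G (P - Q) (P' - Q')"
  by (simp add: polyrel_def diff)

lemma polyrel_mult: "polyrel G P P' \<Longrightarrow> polyrel G Q Q' \<Longrightarrow> polyrel G (P * Q) (P' * Q')"
  by (simp add: polyrel_def coeff_mult sum mult)

lemma polyrel_smult: "(a, b) \<in> G \<Longrightarrow> polyrel G P Q \<Longrightarrow> polyrel G (smult a P) (smult b Q)"
  by (simp add: polyrel_def mult)

lemma polyrel_monom: "(a, b) \<in> G \<Longrightarrow> polyrel G (monom a n) (monom b n)"
  by (simp add: polyrel_def zero)

lemma polyrel_power: "polyrel G P Q \<Longrightarrow> polyrel G (P ^ n) (Q ^ n)"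
  by (induction n) (auto intro: polyrel_mult)

lemma polyrel_prod: "(\<And>i. i \<in> S \<Longrightarrow> polyrel G (f i) (g i)) \<Longrightarrow> polyrel G (prod f S) (prod g S)"
  by (induction S rule: infinite_finite_induct) (auto intro: polyrel_mult)

lemma polyrel_pcompose:
  "polyrel G N N' \<Longrightarrow> polyrel G P P' \<Longrightarrow> polyrel G (pcompose N P) (pcompose N' P')"
proof (induction N arbitrary: N')
  case 0
  then have "\<And>i. coeff N' i = 0"
    using zero_iff by (force simp: polyrel_def)
  then have "N' = 0"
    by (simp add: poly_eq_iff)
  then show ?case by simp
next
  case (pCons a N)
  obtain b N1 where N': "N' = pCons b N1"
    by (cases N')
  have "(a, b) \<in> G" "polyrel G N N1"
    using pCons.prems(1) unfolding N' polyrel_def by (metis coeff_pCons_0, metis coeff_pCons_Suc)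
  then show ?case
    unfolding N' pcompose_pCons using pCons
    by (intro polyrel_add polyrel_mult polyrel_pCons) auto
qed

lemma polyrel_poly:
  assumes "polyrel G P P'" "(a, b) \<in> G"
  shows "(poly P a, poly P' b) \<in> G"
proof -
  have "polyrel G (pcompose P [:a:]) (pcompose P' [:b:])"
    using assms by (intro polyrel_pcompose polyrel_pCons polyrel_0)
  then have "(coeff (pcompose P [:a:]) 0, coeff (pcompose P' [:b:]) 0) \<in> G"
    unfolding polyrel_def by blast
  then show ?thesis
    by (simp add: poly_pcompose flip: poly_0_coeff_0)
qed

lemma polyrel_degree: "polyrel G P P' \<Longrightarrow> degree P = degree P'"
  using zero_iff unfolding polyrel_def degree_def by metis

lemma polyrel_eq_0_iff: "polyrel G P P' \<Longrightarrow> P = 0 \<longleftrightarrow> P' = 0"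
  using zero_iff unfolding polyrel_def poly_eq_iff by (metis coeff_0)

lemma subset_adjoin: "G \<subseteq> adjoin G y z"
proof (clarify)
  fix a b assume "(a, b) \<in> G"
  then have "polyrel G [:a:] [:b:]"
    by (intro polyrel_pCons polyrel_0)
  then show "(a, b) \<in> adjoin G y z"
    unfolding adjoin_def by force
qed

lemma adjoin_self: "(y, z) \<in> adjoin G y z"
proof -
  have "polyrel G [:0, 1:] [:0, 1:]"
    by (intro polyrel_pCons polyrel_0 zero one)
  then show ?thesis
    unfolding adjoin_def by force
qed

lemma ring_graph_adjoin:
  assumes "\<And>P Q. polyrel G P Q \<Longrightarrow> poly P y = 0 \<longleftrightarrow> poly Q z = 0"
  shows "ring_graph (adjoin G y z)"
proof
  show "(0, 0) \<in> adjoin G y z" "(1, 1) \<in> adjoin G y z"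
    using zero one subset_adjoin by blast+
next
  fix a a' b b' assume "(a, a') \<in> adjoin G y z" "(b, b') \<in> adjoin G y z"
  then obtain P P' Q Q' where *: "polyrel G P P'" "polyrel G Q Q'"
    "a = poly P y" "a' = poly P' z" "b = poly Q y" "b' = poly Q' z"
    unfolding adjoin_def by blast
  show "(a + b, a' + b') \<in> adjoin G y z"
    using polyrel_add[OF *(1,2)] unfolding *(3-) adjoin_def by (force simp flip: poly_add)
  show "(a - b, a' - b') \<in> adjoin G y z"
    using polyrel_diff[OF *(1,2)] unfolding *(3-) adjoin_def by (force simp flip: poly_diff)
  show "(a * b, a' * b') \<in> adjoin G y z"
    using polyrel_mult[OF *(1,2)] unfolding *(3-) adjoin_def by (force simp flip: poly_mult)
next
  fix a a' assume "(a, a') \<in> adjoin G y z"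
  then show "a = 0 \<longleftrightarrow> a' = 0"
    using assms unfolding adjoin_def by force
qed

lemma subset_frac_graph: "G \<subseteq> frac_graph G"
  unfolding frac_graph_def using one by force

lemma field_graph_frac_graph: "field_graph (frac_graph G)"
proof
  show "(0, 0) \<in> frac_graph G" "(1, 1) \<in> frac_graph G"
    using zero one subset_frac_graph by blast+
next
  fix a a' b b' assume "(a, a') \<in> frac_graph G" "(b, b') \<in> frac_graph G"
  then obtain p p' q q' r r' s s' where *: "(p, p') \<in> G" "(q, q') \<in> G" "(r, r') \<in> G" "(s, s') \<in> G"
    and nz: "q \<noteq> 0" "s \<noteq> 0" and eqs: "a = p / q" "a' = p' / q'" "b = r / s" "b' = r' / s'"
    unfolding frac_graph_def by blast
  have nz': "q' \<noteq> 0" "s' \<noteq> 0"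
    using nz zero_iff * by blast+
  have den: "(q * s, q' * s') \<in> G" "q * s \<noteq> 0"
    using * nz mult by auto
  have "(p * s + r * q, p' * s' + r' * q') \<in> G" "(p * s - r * q, p' * s' - r' * q') \<in> G"
      "(p * r, p' * r') \<in> G"
    by (simp_all add: * mult add diff)
  then have "((p * s + r * q) / (q * s), (p' * s' + r' * q') / (q' * s')) \<in> frac_graph G"
    "((p * s - r * q) / (q * s), (p' * s' - r' * q') / (q' * s')) \<in> frac_graph G"
    "((p * r) / (q * s), (p' * r') / (q' * s')) \<in> frac_graph G"
    unfolding frac_graph_def using den by force+
  then show "(a + b, a' + b') \<in> frac_graph G" "(a - b, a' - b') \<in> frac_graph G"
    "(a * b, a' * b') \<in> frac_graph G"
    using nz nz' unfolding eqs by (simp_all add: add_frac_eq diff_frac_eq)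
next
  fix a a' assume "(a, a') \<in> frac_graph G"
  then obtain p p' q q' where *: "(p, p') \<in> G" "(q, q') \<in> G"
    and nz: "q \<noteq> 0" and eqs: "a = p / q" "a' = p' / q'"
    unfolding frac_graph_def by blast
  have nz': "q' \<noteq> 0"
    using nz zero_iff * by blast
  show iff: "a = 0 \<longleftrightarrow> a' = 0"
    using zero_iff[OF *(1)] nz nz' by (simp add: eqs)
  show "(inverse a, inverse a') \<in> frac_graph G"
  proof (cases "p = 0")
    case True
    then show ?thesis
      using iff zero subset_frac_graph by (auto simp: eqs)
  next
    case False
    then show ?thesis
      using * unfolding eqs inverse_divide frac_graph_def by blast
  qed
qed

end

text \<open>Euclidean division uses only field operations on coefficients, so it can be run on both
  sides of the graph at once; inverting the leading coefficient is where a field graph is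
  required.\<close>

lemma (in field_graph) polyrel_division:
  assumes M: "polyrel G M M'" "M \<noteq> 0"
  shows "polyrel G P P' \<Longrightarrow> \<exists>S S' T T'. polyrel G S S' \<and> polyrel G T T' \<and>
    P = M * S + T \<and> P' = M' * S' + T' \<and> (T = 0 \<or> degree T < degree M)"
\<comment> \<open>The measure ranks the zero polynomial strictly below the nonzero constants, whose
  degree is also 0.\<close>
proof (induction "if P = 0 then 0 else Suc (degree P)" arbitrary: P P' rule: less_induct)
  case less
  note P = less.prems
  show ?case
  proof (cases "P = 0 \<or> degree P < degree M")
    case True
    then show ?thesis
      using P by (intro exI[of _ 0] exI[of _ P] exI[of _ P']) auto
  next
    case False
    define n where "n = degree P - degree M"
    define c where "c = lead_coeff P * inverse (lead_coeff M)"
    define c' where "c' = lead_coeff P' * inverse (lead_coeff M')"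
    have cc': "(c, c') \<in> G"
      using P M polyrel_degree unfolding c_def c'_def polyrel_def by (metis mult inverse)
    let ?P = "P - M * monom c n" and ?P' = "P' - M' * monom c' n"
    have rel: "polyrel G ?P ?P'"
      by (intro polyrel_diff P polyrel_mult M polyrel_monom cc')
    have "degree (M * monom c n) \<le> degree M + n"
      using degree_mult_le[of M "monom c n"] degree_monom_le[of c n] by linarith
    then have "degree ?P \<le> degree P"
      using False by (intro degree_diff_le) (auto simp: n_def)
    moreover have "coeff ?P (degree P) = 0"
      using False M(2) coeff_mult_degree_sum[of M "monom c n"]
        coeff_monom_mult[of c n M "degree P"]
      by (simp add: n_def c_def mult.commute)
    ultimately have "?P = 0 \<or> degree ?P < degree P"
      by (rule eq_zero_or_degree_less)
    then have "(if ?P = 0 then 0 else Suc (degree ?P)) < (if P = 0 then 0 else Suc (degree P))"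
      using False by auto
    from less.hyps[OF this rel] obtain S S' T T' where
      *: "polyrel G S S'" "polyrel G T T'" "?P = M * S + T" "?P' = M' * S' + T'"
        "T = 0 \<or> degree T < degree M"
      by blast
    have "P = M * (S + monom c n) + T" "P' = M' * (S' + monom c' n) + T'"
      using *(3,4) by (simp_all add: algebra_simps)
    then show ?thesis
      using * polyrel_add[OF *(1) polyrel_monom[OF cc']] by blast
  qed
qed

section \<open>Minimal polynomials and algebraic extension of partial isomorphisms\<close>

locale alg_closure =
  fixes K :: "'k::field set"
  assumes subfield: "is_subfield K"
    and alg_closed: "alg_closed_type TYPE('k)"
    and algebraic: "algebraic_over K"
begin

definition over :: "'k poly \<Rightarrow> bool" where
  "over p \<longleftrightarrow> (\<forall>i. coeff p i \<in> K)"

lemma root_exists: "degree (p :: 'k poly) \<noteq> 0 \<Longrightarrow> \<exists>x. poly p x = 0"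
  using alg_closed by (simp add: alg_closed_type_def)

lemma ex_over_root: "\<exists>p. over p \<and> p \<noteq> 0 \<and> poly p x = 0"
  using algebraic unfolding algebraic_over_def over_def by blast

text \<open>An annihilating polynomial of least degree cannot have constant coefficient 0: as
  \<open>x\<close> is nonzero, dividing by the indeterminate would leave a smaller one.\<close>

lemma ex_over_root_unit:
  assumes "x \<noteq> 0"
  shows "\<exists>p. over p \<and> poly p x = 0 \<and> poly p 0 \<noteq> 0"
proof -
  obtain p where p: "over p \<and> p \<noteq> 0 \<and> poly p x = 0"
    and min: "\<And>q. over q \<and> q \<noteq> 0 \<and> poly q x = 0 \<Longrightarrow> degree p \<le> degree q"
    using ex_has_least_nat[of "\<lambda>p. over p \<and> p \<noteq> 0 \<and> poly p x = 0" _ degree] ex_over_root by blast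
  obtain c q where q: "p = pCons c q"
    by (cases p)
  have "c \<noteq> 0"
  proof
    assume "c = 0"
    then have "over q" "q \<noteq> 0" "poly q x = 0" "degree q < degree p"
      using p assms unfolding q over_def by (auto, metis coeff_pCons_Suc)
    then show False
      using min by force
  qed
  then show ?thesis
    using p q by force
qed

text \<open>Through the diagonal, polynomials over \<open>K\<close> become a case of related
  polynomials, so their closure properties and division come from the graph lemmas.\<close>

lemma field_graph_diag: "field_graph (Id_on K)"
  using subfield by unfold_locales (auto simp: is_subfield_def)

lemma polyrel_diag: "polyrel (Id_on K) P Q \<longleftrightarrow> over P \<and> P = Q"
  unfolding polyrel_def over_def poly_eq_iff Id_on_iff by metis

lemma polyrel_over: "Id_on K \<subseteq> G \<Longrightarrow> over P \<Longrightarrow> polyrel G P P"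
  by (auto simp: polyrel_def over_def)

text \<open>\<open>M\<close> is a minimal polynomial of \<open>y\<close> over the domain of the isomorphism \<open>G\<close>, and \<open>M'\<close> is its image.\<close>

definition min_pair :: "('k \<times> 'k) set \<Rightarrow> 'k \<Rightarrow> 'k poly \<Rightarrow> 'k poly \<Rightarrow> bool" where
  "min_pair G y M M' \<longleftrightarrow> polyrel G M M' \<and> M \<noteq> 0 \<and> poly M y = 0 \<and>
     (\<forall>P P'. polyrel G P P' \<longrightarrow> P \<noteq> 0 \<longrightarrow> poly P y = 0 \<longrightarrow> degree M \<le> degree P)"

lemma ex_min_pair:
  assumes "Id_on K \<subseteq> G"
  shows "\<exists>M M'. min_pair G y M M'"
proof -
  let ?Q = "\<lambda>M. (\<exists>M'. polyrel G M M') \<and> M \<noteq> 0 \<and> poly M y = 0"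
  obtain p where "?Q p"
    using ex_over_root polyrel_over[OF assms] by blast
  then obtain M where "?Q M" "\<And>P. ?Q P \<Longrightarrow> degree M \<le> degree P"
    using ex_has_least_nat[of ?Q p degree] by blast
  then show ?thesis
    unfolding min_pair_def by blast
qed

text \<open>From left to right, the remainder of \<open>P\<close> modulo \<open>M\<close> vanishes
  at \<open>y\<close> and is zero by minimality. Conversely, if \<open>poly P y\<close> were
  nonzero, take \<open>N\<close> over \<open>K\<close> killing it with nonzero constant coefficient:
  by the first direction \<open>N\<close> composed with \<open>P'\<close> vanishes at
  \<open>z\<close>, but its value there is \<open>poly N 0\<close>.\<close>

lemma min_pair_zero_iff:
  assumes "field_graph G" and K: "Id_on K \<subseteq> G"
    and M: "min_pair G y M M'" and z: "poly M' z = 0" and P: "polyrel G P P'"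
  shows "poly P y = 0 \<longleftrightarrow> poly P' z = 0"
proof -
  interpret field_graph G by fact
  have imp: "poly P' z = 0" if PP: "polyrel G P P'" "poly P y = 0" for P P'
  proof -
    obtain S S' T T' where *: "polyrel G S S'" "polyrel G T T'" "P = M * S + T" "P' = M' * S' + T'"
        "T = 0 \<or> degree T < degree M"
      using polyrel_division[of M M' P P'] PP(1) M unfolding min_pair_def by blast
    have "poly T y = 0"
      using PP(2) M by (simp add: *(3) min_pair_def)
    then have "T = 0"
      using M *(2,5) unfolding min_pair_def by (meson leD)
    then have "T' = 0"
      using *(2) polyrel_eq_0_iff by blast
    then show ?thesis
      using z by (simp add: *(4))
  qed
  show ?thesis
  proof
    assume "poly P y = 0"
    then show "poly P' z = 0"
      using imp P by blast
  next
    assume 0: "poly P' z = 0"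
    show "poly P y = 0"
    proof (rule ccontr)
      assume "poly P y \<noteq> 0"
      then obtain N where N: "over N" "poly N (poly P y) = 0" "poly N 0 \<noteq> 0"
        using ex_over_root_unit by blast
      have "polyrel G (pcompose N P) (pcompose N P')"
        using polyrel_pcompose polyrel_over K N(1) P by blast
      then have "poly (pcompose N P') z = 0"
        using imp[of "pcompose N P" "pcompose N P'"] N(2) by (simp add: poly_pcompose)
      then show False
        using 0 N(3) by (simp add: poly_pcompose)
    qed
  qed
qed

lemma min_pair_root:
  assumes "field_graph G" "min_pair G y M M'"
  shows "\<exists>z. poly M' z = 0"
proof -
  interpret field_graph G by fact
  have "degree M \<noteq> 0"
    using assms(2) unfolding min_pair_def
    by (metis degree_eq_zeroE pCons_eq_0_iff poly_pCons poly_0 mult_zero_right add_0_right)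
  then show ?thesis
    using assms(2) polyrel_degree root_exists unfolding min_pair_def by metis
qed

text \<open>No values are controlled here; this version serves to realise arbitrary roots of
  conjugate polynomials.\<close>

lemma extend_field_graph:
  assumes "field_graph G" "Id_on K \<subseteq> G" "min_pair G y M M'" "poly M' z = 0"
  shows "\<exists>H. field_graph H \<and> G \<subseteq> H \<and> (y, z) \<in> H"
proof -
  interpret field_graph G by fact
  interpret H: ring_graph "adjoin G y z"
    by (rule ring_graph_adjoin) (use min_pair_zero_iff assms in blast)
  show ?thesis
    using H.field_graph_frac_graph H.subset_frac_graph subset_adjoin adjoin_self by blast
qed

end

section \<open>Extending partial isomorphisms that preserve values\<close>

definition valued :: "('k::field \<Rightarrow> 'g::linordered_ab_group_add) \<Rightarrow> ('k \<times> 'k) set \<Rightarrow> bool" where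
  "valued u G \<longleftrightarrow> (\<forall>(a, b)\<in>G. a \<noteq> 0 \<longrightarrow> u a = u b)"

text \<open>One Horner step: \<open>poly_shift i N\<close> discards the coefficients below index
  \<open>i\<close>, so these evaluations are the partial Horner sums of \<open>N\<close> at
  \<open>x\<close>.\<close>

lemma poly_poly_shift: "poly (poly_shift i N) x = coeff N i + x * poly (poly_shift (Suc i) N) x"
proof -
  have "poly_shift i N = pCons (coeff N i) (poly_shift (Suc i) N)"
    by (rule poly_eqI) (auto simp: coeff_poly_shift coeff_pCons split: nat.split)
  then show ?thesis
    by simp
qed

context valuation
begin

lemma vge_poly: "\<forall>i. vge u 0 (coeff p i) \<Longrightarrow> vge u 0 x \<Longrightarrow> vge u 0 (poly p x)"
proof (induction p)
  case (pCons a p)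
  have "vge u 0 a" "\<forall>i. vge u 0 (coeff p i)"
    using pCons.prems(1) by (metis coeff_pCons_0, metis coeff_pCons_Suc)
  then show ?case
    using pCons vge_add vge_mult[of 0 x 0 "poly p x"] by simp
qed simp

text \<open>If \<open>x\<close> is integral, so is every polynomial in \<open>x\<close> with
  integral coefficients. Otherwise \<open>inverse x\<close> is integral, and the Horner recursion is
  run upwards from \<open>poly N x = 0\<close>, dividing by \<open>x\<close> each time.\<close>

lemma vge_poly_shift:
  assumes N: "\<forall>i. vge u 0 (coeff N i)" and x: "poly N x = 0"
  shows "vge u 0 (poly (poly_shift i N) x) \<and> vge u 0 (x * poly (poly_shift i N) x)"
proof (cases "vge u 0 x")
  case True
  have "vge u 0 (poly (poly_shift i N) x)"
    using N True by (intro vge_poly) (auto simp: coeff_poly_shift)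
  then show ?thesis
    using vge_mult[OF True, of 0] by simp
next
  case False
  then have "x \<noteq> 0" and inv: "vge u 0 (inverse x)"
    by (auto simp: vge_def val_inverse)
  show ?thesis
  proof (induction i)
    case 0
    have "poly_shift 0 N = N"
      by (rule poly_eqI) (simp add: coeff_poly_shift)
    then show ?case
      using x by simp
  next
    case (Suc i)
    have "vge u 0 (poly (poly_shift i N) x - coeff N i)"
      using Suc N by (intro vge_diff) auto
    then have 1: "vge u 0 (x * poly (poly_shift (Suc i) N) x)"
      by (simp add: poly_poly_shift[of i])
    have "inverse x * (x * poly (poly_shift (Suc i) N) x) = poly (poly_shift (Suc i) N) x"
      using \<open>x \<noteq> 0\<close> by simp
    then show ?case
      using 1 vge_mult[OF inv 1] by (metis add_0)
  qed
qed

text \<open>Each coefficient is a Horner sum minus \<open>x\<close> times the next one. If no Horner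
  sum were a unit, all would have positive value, and so would the unit coefficient
  \<open>coeff N k\<close>.\<close>

lemma ex_poly_shift_unit:
  assumes N: "\<forall>i. vge u 0 (coeff N i)" "coeff N k \<noteq> 0" "u (coeff N k) = 0"
    and x: "poly N x = 0" "x \<noteq> 0" "u x = 0"
  shows "\<exists>i. poly (poly_shift i N) x \<noteq> 0 \<and> u (poly (poly_shift i N) x) = 0"
proof (rule ccontr)
  assume neg: "\<not> ?thesis"
  have gt: "vgt u 0 (poly (poly_shift i N) x)" for i
    using vge_poly_shift[OF N(1) x(1), of i] neg by (auto simp: vge_def vgt_def order.order_iff_strict)
  have "vgt u (0 + 0) (x * poly (poly_shift (Suc k) N) x)"
    by (rule vgt_mult) (use gt x in \<open>auto simp: vge_def\<close>)
  then have "vgt u 0 (poly (poly_shift k N) x - x * poly (poly_shift (Suc k) N) x)"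
    using gt by (intro vgt_diff) auto
  then have "vgt u 0 (coeff N k)"
    by (simp add: poly_poly_shift[of k])
  then show False
    using N by (simp add: vgt_def)
qed

end

locale valued_closure = alg_closure K + valuation u
  for K :: "'k::field set" and u :: "'k \<Rightarrow> 'g::linordered_ab_group_add"
begin

text \<open>Apply \<open>val_torsion\<close> to an equation over \<open>K\<close>. The use: a power
  of any nonzero element can be scaled by an element of \<open>K\<close> to value 0.\<close>

lemma torsion_over:
  assumes "x \<noteq> 0"
  shows "\<exists>k c. 0 < k \<and> c \<in> K \<and> c \<noteq> 0 \<and> gmul k (u x) = u c"
proof -
  obtain p where p: "over p" "p \<noteq> 0" "poly p x = 0"
    using ex_over_root by blast
  obtain i j where ij: "i < j" "coeff p i \<noteq> 0" "coeff p j \<noteq> 0"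
    "gmul (j - i) (u x) = u (coeff p i / coeff p j)"
    using val_torsion[OF p(2,3) assms] by blast
  moreover have "coeff p i / coeff p j \<in> K"
    using p(1) subfield unfolding over_def is_subfield_def divide_inverse by blast
  ultimately show ?thesis
    by (intro exI[of _ "j - i"] exI[of _ "coeff p i / coeff p j"]) auto
qed

lemma over_smult: "c \<in> K \<Longrightarrow> over p \<Longrightarrow> over (smult c p)"
  using subfield by (simp add: over_def is_subfield_def)

lemma ex_primitive_over_root:
  "\<exists>N. over N \<and> poly N x = 0 \<and> N \<noteq> 0 \<and> (\<forall>i. vge u 0 (coeff N i)) \<and>
     (\<exists>k. coeff N k \<noteq> 0 \<and> u (coeff N k) = 0)"
proof -
  obtain p where p: "over p" "p \<noteq> 0" "poly p x = 0"
    using ex_over_root by blast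
  obtain k where k: "coeff p k \<noteq> 0" "u (coeff p k) = gauss u p"
    using gauss_attained[OF p(2)] by blast
  let ?c = "inverse (coeff p k)"
  have c: "?c \<in> K"
    using p(1) subfield by (auto simp: over_def is_subfield_def)
  have "vge u (- gauss u p + gauss u p) (?c * coeff p i)" for i
    using k gauss_le[OF p(2)] by (intro vge_mult) (auto simp: vge_def val_inverse)
  then show ?thesis
    using p k c by (intro exI[of _ "smult ?c p"] conjI over_smult exI[of _ k]) auto
qed

text \<open>Up to sign and the leading coefficient, the lower coefficients are elementary symmetric
  functions of the roots; the induction splits off one linear factor at a time.\<close>

lemma coeff_vgt_of_roots:
  fixes p :: "'k poly"
  assumes "p \<noteq> 0" "\<And>r. poly p r = 0 \<Longrightarrow> vgt u 0 r" "i < degree p"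
  shows "vgt u (u (lead_coeff p)) (coeff p i)"
  using assms
proof (induction "degree p" arbitrary: p i)
  case (Suc n)
  obtain r where r: "poly p r = 0"
    using root_exists[of p] Suc.hyps(2) by auto
  then obtain q where q: "p = [:- r, 1:] * q"
    using poly_eq_0_iff_dvd[of p r] unfolding dvd_def by blast
  have "q \<noteq> 0"
    using Suc.prems q by auto
  then have deg: "degree p = Suc (degree q)"
    unfolding q by (subst degree_mult_eq) auto
  have lead: "lead_coeff p = lead_coeff q"
    unfolding q by (simp only: lead_coeff_mult) simp
  have IH: "vgt u (u (lead_coeff q)) (coeff q j)" if "j < degree q" for j
    using Suc deg \<open>q \<noteq> 0\<close> that by (intro Suc.hyps(1)) (auto simp: q)
  have vq: "vge u (u (lead_coeff q)) (coeff q i)"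
    using IH[of i] Suc.prems(3) deg by (cases "i = degree q") (auto simp: vge_def vgt_imp_vge vgt_def)
  have "vgt u (u (lead_coeff q) + 0) (coeff q i * r)"
    using vq Suc.prems(2)[OF r] by (rule vgt_mult)
  moreover have "vgt u (u (lead_coeff q)) (coeff (pCons 0 q) i)"
    using IH[of "i - 1"] Suc.prems(3) deg by (cases i) auto
  ultimately have "vgt u (u (lead_coeff q)) (coeff (pCons 0 q) i - coeff q i * r)"
    by (intro vgt_diff) auto
  moreover have "coeff p i = coeff (pCons 0 q) i - coeff q i * r"
    unfolding q by (simp add: mult.commute)
  ultimately show ?case
    using lead by simp
qed auto

lemma poly_neq_0_of_dominant_lead:
  fixes p :: "'k poly"
  assumes "p \<noteq> 0" "\<And>i. i < degree p \<Longrightarrow> vgt u (u (lead_coeff p)) (coeff p i)" "x \<noteq> 0" "u x = 0"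
  shows "poly p x \<noteq> 0"
proof -
  let ?t = "\<lambda>i. coeff p i * x ^ i"
  have ux: "u (x ^ i) = 0" for i
    using assms by (simp add: val_power)
  have lead: "?t (degree p) \<noteq> 0" "u (?t (degree p)) = u (lead_coeff p)"
    using assms ux by (auto simp: val_mult)
  have "vgt u (0 + u (lead_coeff p)) (x ^ i * coeff p i)" if "i < degree p" for i
    by (rule vgt_mult) (use that assms ux in \<open>auto simp: vge_def\<close>)
  then have "vgt u (u (?t (degree p))) (\<Sum>i<degree p. ?t i)"
    unfolding lead(2) by (intro vgt_sum) (auto simp: mult.commute)
  then have "?t (degree p) + (\<Sum>i<degree p. ?t i) \<noteq> 0"
    using val_add_eq lead(1) by blast
  moreover have "poly p x = ?t (degree p) + (\<Sum>i<degree p. ?t i)"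
    unfolding poly_altdef lessThan_Suc_atMost[symmetric] by (simp add: add.commute)
  ultimately show ?thesis
    by simp
qed

text \<open>Scale \<open>P\<close> to an element \<open>Q\<close> of value 0 at \<open>y\<close>. The partial Horner sums \<open>b\<close> of a primitive equation for
  \<open>Q\<close> over \<open>K\<close> have the property that \<open>b\<close> and \<open>b Q\<close> lie in every valuation ring above \<open>U \<inter> K\<close>; one of the \<open>b\<close> is a
  unit at \<open>y\<close>, and then \<open>b\<close> or \<open>b Q\<close> separates the two valuations.\<close>

lemma ex_separating_pair:
  assumes fg: "field_graph G" and K: "Id_on K \<subseteq> G" and M: "min_pair G y M M'"
    and z: "poly M' z = 0"
    and P: "polyrel G P P'" "poly P y \<noteq> 0" "u (poly P y) \<noteq> u (poly P' z)"
  shows "\<exists>Q Q'. polyrel G Q Q' \<and> poly Q y \<noteq> 0 \<and> u (poly Q y) = 0 \<and> vgt u 0 (poly Q' z) \<and>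
    (\<forall>z'. poly M' z' = 0 \<longrightarrow> vge u 0 (poly Q' z'))"
proof -
  interpret field_graph G by fact
  have P'z: "poly P' z \<noteq> 0"
    using min_pair_zero_iff[OF fg K M z P(1)] P(2) by blast
  obtain k c where kc: "0 < k" "c \<in> K" "c \<noteq> 0" "gmul k (u (poly P y)) = u c"
    using torsion_over[OF P(2)] by blast
  have "inverse c \<in> K"
    using kc(2) subfield by (auto simp: is_subfield_def)
  define Q where "Q = smult (inverse c) (P ^ k)"
  define Q' where "Q' = smult (inverse c) (P' ^ k)"
  have Q: "polyrel G Q Q'"
    unfolding Q_def Q'_def using K \<open>inverse c \<in> K\<close> P(1) by (intro polyrel_smult polyrel_power) auto
  have y: "poly Q y \<noteq> 0" "u (poly Q y) = 0"
    using kc P by (auto simp: Q_def val_mult val_inverse val_power)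
  have zQ: "poly Q' z \<noteq> 0" "u (poly Q' z) \<noteq> 0"
    using kc P P'z gmul_inject[OF kc(1), of "u (poly P y)" "u (poly P' z)"]
    by (auto simp: Q'_def val_mult val_inverse val_power)
  obtain N n where N: "over N" "poly N (poly Q y) = 0" "\<forall>i. vge u 0 (coeff N i)"
    "coeff N n \<noteq> 0" "u (coeff N n) = 0"
    using ex_primitive_over_root[of "poly Q y"] by blast
  \<comment> \<open>\<open>N\<close> also annihilates \<open>Q'\<close> at every root of
    \<open>M'\<close>, so its Horner sums are integral there as well.\<close>
  have N': "poly N (poly Q' z') = 0" if "poly M' z' = 0" for z'
    using min_pair_zero_iff[OF fg K M that, of "pcompose N Q" "pcompose N Q'"] N(2)
      polyrel_pcompose[OF polyrel_over[OF K N(1)] Q] by (simp add: poly_pcompose)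
  obtain i where i: "poly (poly_shift i N) (poly Q y) \<noteq> 0" "u (poly (poly_shift i N) (poly Q y)) = 0"
    using ex_poly_shift_unit N y by blast
  define B where "B = poly_shift i N"
  have B: "over B"
    using N(1) subfield by (auto simp: B_def over_def coeff_poly_shift)
  have vB: "vge u 0 (poly B (poly Q' z'))" "vge u 0 (poly Q' z' * poly B (poly Q' z'))"
    if "poly M' z' = 0" for z'
    using vge_poly_shift[OF N(3) N'[OF that]] unfolding B_def by blast+
  have BQ: "polyrel G (pcompose B Q) (pcompose B Q')"
    by (rule polyrel_pcompose[OF polyrel_over[OF K B] Q])
  show ?thesis
  proof (cases "u (poly Q' z) < 0")
    case True
    have "vgt u 0 (poly B (poly Q' z))"
    proof (cases "poly B (poly Q' z) = 0")
      case False
      then have "0 \<le> u (poly Q' z) + u (poly B (poly Q' z))"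
        using vB(2)[OF z] zQ by (simp add: vge_def val_mult)
      then show ?thesis
        using True by (metis add_strict_right_mono add_0 le_less_trans vgt_def)
    qed simp
    then show ?thesis
      using BQ vB i
      by (intro exI[of _ "pcompose B Q"] exI[of _ "pcompose B Q'"]) (auto simp: poly_pcompose B_def)
  next
    case False
    have "vgt u (0 + 0) (poly B (poly Q' z) * poly Q' z)"
      using vB(1)[OF z] False zQ by (intro vgt_mult) (auto simp: vgt_def)
    then show ?thesis
      using polyrel_mult[OF Q BQ] vB i y
      by (intro exI[of _ "Q * pcompose B Q"] exI[of _ "Q' * pcompose B Q'"])
        (auto simp: poly_pcompose B_def val_mult mult.commute)
  qed
qed

text \<open>Suppose no root of the conjugate minimal polynomial \<open>M'\<close> preserves values.
  The product \<open>X\<close> of the separating elements is a unit at \<open>y\<close>, while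
  \<open>X'\<close> has positive value at every root in \<open>Z\<close>. The image
  \<open>N'\<close> of the minimal polynomial \<open>N\<close> of \<open>poly X y\<close> has only
  such values as roots, so the leading coefficient dominates in \<open>N'\<close> and hence in
  \<open>N\<close>; then the unit \<open>poly X y\<close> cannot be a root of
  \<open>N\<close>.\<close>

lemma extend_valued_graph:
  assumes fg: "field_graph G" and K: "Id_on K \<subseteq> G" and val: "valued u G"
  shows "\<exists>z. ring_graph (adjoin G y z) \<and> valued u (adjoin G y z)"
proof (rule ccontr)
  assume neg: "\<not> ?thesis"
  interpret field_graph G by fact
  obtain M M' where M: "min_pair G y M M'"
    using ex_min_pair[OF K] by blast
  define Z where "Z = {z. poly M' z = 0}"
  have M': "polyrel G M M'" "M' \<noteq> 0" "poly M y = 0"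
    using M polyrel_eq_0_iff unfolding min_pair_def by blast+
  have fin: "finite Z"
    unfolding Z_def using M'(2) by (rule poly_roots_finite)
  have "\<exists>Q Q'. polyrel G Q Q' \<and> poly Q y \<noteq> 0 \<and> u (poly Q y) = 0 \<and> vgt u 0 (poly Q' z) \<and>
    (\<forall>z'\<in>Z. vge u 0 (poly Q' z'))" if "z \<in> Z" for z
  proof -
    have z: "poly M' z = 0"
      using that by (simp add: Z_def)
    have "ring_graph (adjoin G y z)"
      by (rule ring_graph_adjoin) (rule min_pair_zero_iff[OF fg K M z])
    with neg have "\<not> valued u (adjoin G y z)"
      by blast
    then obtain P P' where "polyrel G P P'" "poly P y \<noteq> 0" "u (poly P y) \<noteq> u (poly P' z)"
      unfolding valued_def adjoin_def by blast
    from ex_separating_pair[OF fg K M z this] show ?thesis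
      by (simp add: Z_def)
  qed
  then obtain Q Q' where Q: "\<And>z. z \<in> Z \<Longrightarrow> polyrel G (Q z) (Q' z)"
    "\<And>z. z \<in> Z \<Longrightarrow> poly (Q z) y \<noteq> 0" "\<And>z. z \<in> Z \<Longrightarrow> u (poly (Q z) y) = 0"
    "\<And>z. z \<in> Z \<Longrightarrow> vgt u 0 (poly (Q' z) z)"
    "\<And>z z'. z \<in> Z \<Longrightarrow> z' \<in> Z \<Longrightarrow> vge u 0 (poly (Q' z) z')"
    by metis
  define X where "X = prod Q Z"
  define X' where "X' = prod Q' Z"
  have X: "polyrel G X X'"
    unfolding X_def X'_def by (intro polyrel_prod Q)
  have "finite S \<Longrightarrow> S \<subseteq> Z \<Longrightarrow> (\<Prod>z\<in>S. poly (Q z) y) \<noteq> 0 \<and> u (\<Prod>z\<in>S. poly (Q z) y) = 0" for S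
    by (induction S rule: finite_induct) (auto simp: val_mult Q)
  then have Xy: "poly X y \<noteq> 0" "u (poly X y) = 0"
    using fin unfolding X_def poly_prod by blast+
  have X'z: "vgt u 0 (poly X' z)" if z: "z \<in> Z" for z
  proof -
    have "finite S \<Longrightarrow> S \<subseteq> Z \<Longrightarrow> vge u 0 (\<Prod>z'\<in>S. poly (Q' z') z)" for S
    proof (induction S rule: finite_induct)
      case (insert a S)
      then have "vge u (0 + 0) (poly (Q' a) z * (\<Prod>z'\<in>S. poly (Q' z') z))"
        by (intro vge_mult Q) (auto simp: z)
      then show ?case
        using insert by simp
    qed (simp add: vge_def)
    then have "vge u 0 (\<Prod>z'\<in>Z - {z}. poly (Q' z') z)"
      using fin by blast
    then have "vgt u (0 + 0) ((\<Prod>z'\<in>Z - {z}. poly (Q' z') z) * poly (Q' z) z)"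
      by (rule vgt_mult) (rule Q(4)[OF z])
    then show ?thesis
      unfolding X'_def poly_prod by (simp add: prod.remove[OF fin z] poly_prod mult.commute)
  qed
  obtain N N' where N: "min_pair G (poly X y) N N'"
    using ex_min_pair[OF K] by blast
  have NN: "polyrel G N N'" "N \<noteq> 0" "poly N (poly X y) = 0"
    using N unfolding min_pair_def by blast+
  have N'0: "N' \<noteq> 0" and deg: "degree N' = degree N"
    using NN polyrel_eq_0_iff polyrel_degree by auto
  \<comment> \<open>Each root \<open>r\<close> of \<open>N'\<close> is \<open>poly X' z\<close> for some \<open>z \<in> Z\<close>: extend \<open>G\<close> by \<open>poly X y \<mapsto> r\<close>, then to \<open>y\<close>.\<close>
  have roots: "vgt u 0 r" if r: "poly N' r = 0" for r
  proof -
    obtain H1 where H1: "field_graph H1" "G \<subseteq> H1" "(poly X y, r) \<in> H1"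
      using extend_field_graph[OF fg K N r] by blast
    have K1: "Id_on K \<subseteq> H1"
      using K H1(2) by blast
    obtain L L' where L: "min_pair H1 y L L'"
      using ex_min_pair[OF K1] by blast
    obtain z where z: "poly L' z = 0"
      using min_pair_root[OF H1(1) L] by blast
    obtain H2 where H2: "field_graph H2" "H1 \<subseteq> H2" "(y, z) \<in> H2"
      using extend_field_graph[OF H1(1) K1 L z] by blast
    interpret H2: field_graph H2 by fact
    have rel: "polyrel H2 A A'" if "polyrel G A A'" for A A'
      using that H1(2) H2(2) unfolding polyrel_def by blast
    have "(poly M y, poly M' z) \<in> H2"
      using H2.polyrel_poly rel M'(1) H2(3) by blast
    then have "z \<in> Z"
      using M'(3) H2.zero_iff unfolding Z_def by blast
    have "(poly X y, poly X' z) \<in> H2"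
      using H2.polyrel_poly rel X H2(3) by blast
    moreover have "(poly X y, r) \<in> H2"
      using H1(3) H2(2) by blast
    ultimately have "r = poly X' z"
      using H2.functional by blast
    then show ?thesis
      using X'z[OF \<open>z \<in> Z\<close>] by simp
  qed
  \<comment> \<open>\<open>G\<close> preserves values and zeros, so dominance of the leading
    coefficient passes from \<open>N'\<close> back to \<open>N\<close>.\<close>
  have v: "(coeff N i \<noteq> 0 \<longrightarrow> u (coeff N i) = u (coeff N' i)) \<and> (coeff N i = 0 \<longleftrightarrow> coeff N' i = 0)" for i
    using NN(1) val zero_iff unfolding polyrel_def valued_def by blast
  have "vgt u (u (lead_coeff N)) (coeff N i)" if i: "i < degree N" for i
  proof -
    have "vgt u (u (lead_coeff N')) (coeff N' i)"
      using coeff_vgt_of_roots[OF N'0 roots] i deg by simp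
    moreover have "u (lead_coeff N) = u (lead_coeff N')"
      using v[of "degree N"] NN(2) deg by simp
    ultimately show ?thesis
      using v[of i] by (auto simp: vgt_def)
  qed
  from poly_neq_0_of_dominant_lead[OF NN(2) this Xy] show False
    using NN(3) by blast
qed

lemma valued_frac_graph:
  assumes "ring_graph G" "valued u G"
  shows "valued u (frac_graph G)"
  unfolding valued_def
proof clarify
  interpret ring_graph G by fact
  fix a a' assume "(a, a') \<in> frac_graph G" "a \<noteq> 0"
  then obtain p p' q q' where *: "(p, p') \<in> G" "(q, q') \<in> G"
    and nz: "q \<noteq> 0" "p \<noteq> 0" and eqs: "a = p / q" "a' = p' / q'"
    unfolding frac_graph_def by force
  have "u p = u p'" "u q = u q'" "p' \<noteq> 0" "q' \<noteq> 0"
    using * nz assms(2) zero_iff[OF *(1)] zero_iff[OF *(2)] unfolding valued_def by auto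
  then show "u a = u a'"
    using nz by (simp add: eqs val_divide)
qed

text \<open>Zorn's lemma gives a maximal value-preserving graph \<open>H\<close> containing
  \<open>G\<close>. Maximality makes it closed under fractions and, by
  \<open>extend_valued_graph\<close>, defined everywhere, so it is the graph of a map
  \<open>\<sigma>\<close>.\<close>

theorem extend_to_decomp_group:
  assumes G: "ring_graph G" and K: "Id_on K \<subseteq> G" and val: "valued u G"
  shows "\<exists>\<sigma>\<in>decomp_group K u. \<forall>(a, b)\<in>G. \<sigma> a = b"
proof -
  define A where "A = {H. G \<subseteq> H \<and> ring_graph H \<and> valued u H}"
  have "\<exists>H\<in>A. \<forall>X\<in>A. H \<subseteq> X \<longrightarrow> X = H"
  proof (rule subset_Zorn_nonempty)
    show "A \<noteq> {}"
      using G val unfolding A_def by blast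
  next
    fix C assume ne: "C \<noteq> {}" and chain: "subset.chain A C"
    have sub: "\<And>H. H \<in> C \<Longrightarrow> G \<subseteq> H \<and> ring_graph H \<and> valued u H"
      using chain unfolding A_def subset_chain_def by blast
    have two: "\<exists>H\<in>C. p \<in> H \<and> q \<in> H" if "p \<in> \<Union> C" "q \<in> \<Union> C" for p q
    proof -
      obtain H1 H2 where "H1 \<in> C" "H2 \<in> C" "p \<in> H1" "q \<in> H2"
        using \<open>p \<in> \<Union> C\<close> \<open>q \<in> \<Union> C\<close> by blast
      moreover have "H1 \<subseteq> H2 \<or> H2 \<subseteq> H1"
        using chain calculation unfolding subset_chain_def by blast
      ultimately show ?thesis
        by blast
    qed
    have "ring_graph (\<Union> C)"
    proof
      show "(0, 0) \<in> \<Union> C" "(1, 1) \<in> \<Union> C"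
        using ne sub ring_graph.zero ring_graph.one by blast+
    next
      fix a a' b b' assume "(a, a') \<in> \<Union> C" "(b, b') \<in> \<Union> C"
      then obtain H where H: "H \<in> C" "(a, a') \<in> H" "(b, b') \<in> H"
        using two by blast
      interpret ring_graph H
        using sub H(1) by blast
      show "(a + b, a' + b') \<in> \<Union> C" "(a - b, a' - b') \<in> \<Union> C" "(a * b, a' * b') \<in> \<Union> C"
        using add[OF H(2,3)] diff[OF H(2,3)] mult[OF H(2,3)] H(1) by blast+
    next
      fix a a' assume "(a, a') \<in> \<Union> C"
      then show "a = 0 \<longleftrightarrow> a' = 0"
        using sub ring_graph.zero_iff by blast
    qed
    moreover have "valued u (\<Union> C)"
      using sub unfolding valued_def by blast
    moreover have "G \<subseteq> \<Union> C"
      using ne sub by blast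
    ultimately show "\<Union> C \<in> A"
      unfolding A_def by blast
  qed
  then obtain H where H: "G \<subseteq> H" "ring_graph H" "valued u H"
    and max: "\<And>X. ring_graph X \<Longrightarrow> valued u X \<Longrightarrow> H \<subseteq> X \<Longrightarrow> X = H"
    unfolding A_def by auto
  interpret ring_graph H by fact
  have KH: "Id_on K \<subseteq> H"
    using K H(1) by blast
  have "frac_graph H = H"
    using max valued_frac_graph[OF H(2,3)] subset_frac_graph field_graph_frac_graph
    unfolding field_graph_def by blast
  then have fH: "field_graph H"
    using field_graph_frac_graph by simp
  have "\<exists>z. (y, z) \<in> H" for y
  proof -
    obtain z where "ring_graph (adjoin H y z)" "valued u (adjoin H y z)"
      using extend_valued_graph[OF fH KH H(3)] by blast
    then have "adjoin H y z = H"
      using max subset_adjoin by blast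
    then show ?thesis
      using adjoin_self by blast
  qed
  then obtain \<sigma> where \<sigma>: "\<And>y. (y, \<sigma> y) \<in> H"
    by metis
  have eq: "\<sigma> a = b" if "(a, b) \<in> H" for a b
    using functional \<sigma> that by blast
  have hom: "\<sigma> (x + y) = \<sigma> x + \<sigma> y" "\<sigma> (x * y) = \<sigma> x * \<sigma> y" for x y
    using eq add mult \<sigma> by blast+
  have fix_K: "\<sigma> x = x" if "x \<in> K" for x
    using eq KH that by blast
  have inj: "inj \<sigma>"
  proof (rule injI)
    fix x y assume "\<sigma> x = \<sigma> y"
    then have "(x - y, 0) \<in> H"
      using diff[OF \<sigma>[of x] \<sigma>[of y]] by simp
    then show "x = y"
      using zero_iff by force
  qed
  \<comment> \<open>\<open>\<sigma>\<close> maps the finite root set of a polynomial over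
    \<open>K\<close> injectively into itself, hence onto itself.\<close>
  have "y \<in> range \<sigma>" for y
  proof -
    obtain p where p: "over p" "p \<noteq> 0" "poly p y = 0"
      using ex_over_root by blast
    define S where "S = {x. poly p x = 0}"
    have fin: "finite S"
      unfolding S_def using p(2) by (rule poly_roots_finite)
    have "\<sigma> ` S \<subseteq> S"
    proof clarify
      fix x assume "x \<in> S"
      then show "\<sigma> x \<in> S"
        using polyrel_poly[OF polyrel_over[OF KH p(1)] \<sigma>[of x]] zero_iff unfolding S_def by blast
    qed
    then have "\<sigma> ` S = S"
      using fin inj by (meson endo_inj_surj inj_on_subset subset_UNIV)
    then show ?thesis
      using p(3) unfolding S_def by blast
  qed
  then have bij: "bij \<sigma>"
    using inj unfolding bij_def by blast
  have u\<sigma>: "u (\<sigma> x) = u x \<and> \<sigma> x \<noteq> 0" if "x \<noteq> 0" for x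
    using \<sigma>[of x] H(3) zero_iff that unfolding valued_def by force
  have \<sigma>0: "\<sigma> 0 = 0"
    using zero eq by blast
  have "x \<in> val_ring u \<longleftrightarrow> \<sigma> x \<in> val_ring u" for x
    using u\<sigma>[of x] \<sigma>0 unfolding val_ring_def by (cases "x = 0") auto
  then have "\<sigma> ` val_ring u = val_ring u"
    using bij unfolding bij_def surj_def by (auto, metis image_eqI)
  then have "\<sigma> \<in> decomp_group K u"
    using bij hom fix_K eq[OF one] unfolding decomp_group_def gal_def by blast
  then show ?thesis
    using eq H(1) by blast
qed

end

section \<open>Valuations of polynomials and the Galois action\<close>

definition ring_of :: "('k::field poly \<Rightarrow> 'g::linordered_ab_group_add) \<Rightarrow> 'k poly fract set" where
  "ring_of w = {f. \<exists>p q. q \<noteq> 0 \<and> f = Fract p q \<and> (p = 0 \<or> w q \<le> w p)}"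

lemma U_ad_eq_ring_of: "U_ad u \<alpha> \<delta> = ring_of (mono_val u \<alpha> \<delta>)"
  by (simp add: U_ad_def ring_of_def)

lemma ring_of_cong: "(\<And>p. p \<noteq> 0 \<Longrightarrow> w p = w' p) \<Longrightarrow> ring_of w = ring_of w'"
  unfolding ring_of_def by (intro Collect_cong) metis

locale poly_valuation = valuation u for u :: "'k::field \<Rightarrow> 'g::linordered_ab_group_add" +
  fixes w :: "'k poly \<Rightarrow> 'g"
  assumes poly_val: "poly_val u w"
begin

lemma pv_mult: "p \<noteq> 0 \<Longrightarrow> q \<noteq> 0 \<Longrightarrow> w (p * q) = w p + w q"
  using poly_val by (simp add: poly_val_def)

lemma pv_add: "p \<noteq> 0 \<Longrightarrow> q \<noteq> 0 \<Longrightarrow> p + q \<noteq> 0 \<Longrightarrow> min (w p) (w q) \<le> w (p + q)"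
  using poly_val by (simp add: poly_val_def)

lemma pv_const [simp]: "c \<noteq> 0 \<Longrightarrow> w [:c:] = u c"
  using poly_val by (simp add: poly_val_def)

lemma pv_1 [simp]: "w 1 = 0"
  using pv_const[of 1] by (simp add: one_pCons)

lemma pv_smult: "c \<noteq> 0 \<Longrightarrow> p \<noteq> 0 \<Longrightarrow> w (smult c p) = u c + w p"
  using pv_mult[of "[:c:]" p] by simp

lemma pv_minus [simp]: "w (- p) = w p"
  using pv_smult[of "- 1" p] by (cases "p = 0") auto

lemma pv_power: "p \<noteq> 0 \<Longrightarrow> w (p ^ n) = gmul n (w p)"
  by (induction n) (auto simp: pv_mult)

lemma pv_add_ge:
  assumes "p = 0 \<or> g \<le> w p" "q = 0 \<or> g \<le> w q"
  shows "p + q = 0 \<or> g \<le> w (p + q)"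
  using assms pv_add[of p q]
  by (cases "p = 0"; cases "q = 0"; cases "p + q = 0") (auto simp: min_le_iff_disj)

lemma pv_add_gt:
  assumes "p = 0 \<or> g < w p" "q = 0 \<or> g < w q"
  shows "p + q = 0 \<or> g < w (p + q)"
  using assms pv_add[of p q]
  by (cases "p = 0"; cases "q = 0"; cases "p + q = 0") (auto simp: min_le_iff_disj)

lemma pv_diff_ge: "p = 0 \<or> g \<le> w p \<Longrightarrow> q = 0 \<or> g \<le> w q \<Longrightarrow> p - q = 0 \<or> g \<le> w (p - q)"
  using pv_add_ge[of p g "- q"] by simp

text \<open>Cross-multiplying two representations shows that comparing \<open>w q\<close> with
  \<open>w p\<close> does not depend on the chosen numerator and denominator.\<close>

lemma Fract_in_ring_of:
  assumes "q \<noteq> 0"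
  shows "Fract p q \<in> ring_of w \<longleftrightarrow> p = 0 \<or> w q \<le> w p"
proof
  assume "Fract p q \<in> ring_of w"
  then obtain p' q' where *: "q' \<noteq> 0" "Fract p q = Fract p' q'" "p' = 0 \<or> w q' \<le> w p'"
    unfolding ring_of_def by blast
  have eq: "p * q' = p' * q"
    using * assms by (simp add: eq_fract)
  show "p = 0 \<or> w q \<le> w p"
  proof (cases "p = 0")
    case False
    then have "p' \<noteq> 0"
      using eq * by auto
    then have "w p + w q' = w p' + w q" "w q' \<le> w p'"
      using False * assms eq pv_mult by metis+
    then have "w q' + w q \<le> w q' + w p"
      by (metis add.commute add_right_mono)
    then show ?thesis
      by simp
  qed simp
qed (use assms in \<open>auto simp: ring_of_def\<close>)

lemma const_fr_in_ring_of: "const_fr c \<in> ring_of w \<longleftrightarrow> c \<in> val_ring u"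
  by (cases "c = 0") (auto simp: const_fr_def Fract_in_ring_of val_ring_def)

lemma is_valuation_domain_ring_of: "is_valuation_domain (ring_of w)"
  unfolding is_valuation_domain_def
proof (intro conjI ballI allI impI)
  show "0 \<in> ring_of w" "1 \<in> ring_of w"
    by (simp_all add: Zero_fract_def One_fract_def Fract_in_ring_of)
next
  fix x y assume xy: "x \<in> ring_of w" "y \<in> ring_of w"
  obtain p q where x: "x = Fract p q" "q \<noteq> 0"
    by (cases x)
  obtain r s where y: "y = Fract r s" "s \<noteq> 0"
    by (cases y)
  have px: "p = 0 \<or> w q \<le> w p" and ry: "r = 0 \<or> w s \<le> w r"
    using xy x y Fract_in_ring_of by blast+
  have 1: "p * s = 0 \<or> w (q * s) \<le> w (p * s)"
    using px x y by (cases "p = 0") (auto simp: pv_mult)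
  have 2: "r * q = 0 \<or> w (q * s) \<le> w (r * q)"
    using ry x y by (cases "r = 0") (auto simp: pv_mult add.commute)
  have "p * s + r * q = 0 \<or> w (q * s) \<le> w (p * s + r * q)"
    using 1 2 by (rule pv_add_ge)
  then show "x + y \<in> ring_of w"
    using x y by (simp add: Fract_in_ring_of)
  have "p * s - r * q = 0 \<or> w (q * s) \<le> w (p * s - r * q)"
    using 1 2 by (rule pv_diff_ge)
  then show "x - y \<in> ring_of w"
    using x y by (simp add: Fract_in_ring_of)
  show "x * y \<in> ring_of w"
    using x y px ry by (cases "p = 0"; cases "r = 0") (auto simp: Fract_in_ring_of pv_mult add_mono)
next
  fix x :: "'k poly fract" assume "x \<noteq> 0"
  obtain p q where x: "x = Fract p q" "q \<noteq> 0"
    by (cases x)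
  then show "x \<in> ring_of w \<or> inverse x \<in> ring_of w"
    by (cases "p = 0") (auto simp: Fract_in_ring_of)
qed

end

section \<open>Valuations of polynomials are determined on linear factors\<close>

context valued_closure
begin

text \<open>Every nonzero polynomial splits over an algebraically closed field; multiplicative
  claims need checking only on constants and on \<open>X - b\<close>.\<close>

lemma poly_induct_linear [consumes 1, case_names const linear mult]:
  fixes p :: "'k poly"
  assumes "p \<noteq> 0" and const: "\<And>c. c \<noteq> 0 \<Longrightarrow> P [:c:]" and linear: "\<And>b. P [:- b, 1:]"
    and mult: "\<And>p q. p \<noteq> 0 \<Longrightarrow> q \<noteq> 0 \<Longrightarrow> P p \<Longrightarrow> P q \<Longrightarrow> P (p * q)"
  shows "P p"
  using assms(1)
proof (induction "degree p" arbitrary: p)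
  case 0
  then show ?case
    using const by (metis degree_eq_zeroE pCons_eq_0_iff)
next
  case (Suc n)
  obtain r where r: "poly p r = 0"
    using root_exists[of p] Suc.hyps(2) by auto
  then obtain q where q: "p = [:- r, 1:] * q"
    using poly_eq_0_iff_dvd[of p r] unfolding dvd_def by blast
  have "q \<noteq> 0"
    using Suc.prems q by auto
  then have "degree p = Suc (degree q)"
    unfolding q by (subst degree_mult_eq) auto
  then show ?case
    using Suc.hyps \<open>q \<noteq> 0\<close> linear mult[of "[:- r, 1:]" q] unfolding q by auto
qed

lemma poly_val_le:
  assumes "poly_val u w" "poly_val u w'" "\<And>b. w [:- b, 1:] \<le> w' [:- b, 1:]" "p \<noteq> 0"
  shows "w p \<le> w' p"
  using assms(4)
proof (induction p rule: poly_induct_linear)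
  case (const c)
  then show ?case
    using assms(1,2) by (simp add: poly_val_def)
next
  case (mult p q)
  then show ?case
    using assms(1,2) by (simp add: poly_val_def add_mono)
qed (rule assms(3))

lemma poly_val_eq:
  assumes "poly_val u w" "poly_val u w'" "\<And>b. w [:- b, 1:] = w' [:- b, 1:]" "p \<noteq> 0"
  shows "w p = w' p"
  using poly_val_le[of w w' p] poly_val_le[of w' w p] assms by simp

lemma poly_valuation_mono_val: "\<delta> \<in> value_group u \<Longrightarrow> poly_valuation u (mono_val u \<alpha> \<delta>)"
  by unfold_locales (rule poly_val_mono_val)

lemma mono_val_attained:
  assumes "\<delta> \<in> value_group u" "p \<noteq> 0"
  shows "\<exists>c. c \<noteq> 0 \<and> mono_val u \<alpha> \<delta> p = u c"
proof -
  obtain d where d: "d \<noteq> 0" "\<delta> = u d"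
    using assms by (auto simp: value_group_def)
  then have "pcompose p [:\<alpha>, d:] \<noteq> 0"
    using assms(2) pcompose_eq_0[of p "[:\<alpha>, d:]"] by auto
  then show ?thesis
    using gauss_attained mono_val_eq_gauss[OF d(1)] d(2) by metis
qed

text \<open>A valuation ring in general fixes its valuation only up to equivalence. Here a constant
  \<open>c\<close> with \<open>w p = u c\<close> exists, and comparing \<open>p\<close> with
  \<open>c\<close> reads the value off the ring.\<close>

lemma ring_of_inject:
  assumes w: "poly_val u w" "\<And>p. p \<noteq> 0 \<Longrightarrow> \<exists>c. c \<noteq> 0 \<and> w p = u c" and w': "poly_val u w'"
    and eq: "ring_of w = ring_of w'" and p: "p \<noteq> 0"
  shows "w p = w' p"
proof -
  interpret w: poly_valuation u w by unfold_locales fact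
  interpret w': poly_valuation u w' by unfold_locales fact
  obtain c where c: "c \<noteq> 0" "w p = u c"
    using w(2) p by blast
  have "Fract p [:c:] \<in> ring_of w" "Fract [:c:] p \<in> ring_of w"
    using c p by (auto simp: w.Fract_in_ring_of)
  then show ?thesis
    unfolding eq using c p by (auto simp: w'.Fract_in_ring_of)
qed

text \<open>It suffices to compare on linear polynomials, where the ultrametric inequality gives one
  direction; the other follows by exchanging the centres.\<close>

lemma mono_val_ball:
  assumes \<delta>: "\<delta> \<in> value_group u" and ball: "vge u \<delta> (\<beta> - \<alpha>)" and p: "p \<noteq> 0"
  shows "mono_val u \<beta> \<delta> p = mono_val u \<alpha> \<delta> p"
proof (rule poly_val_eq[OF poly_val_mono_val[OF \<delta>] poly_val_mono_val[OF \<delta>] _ p])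
  have le: "mono_val u \<beta> \<delta> [:- b, 1:] \<le> mono_val u \<alpha> \<delta> [:- b, 1:]" if "vge u \<delta> (\<alpha> - \<beta>)" for b \<alpha> \<beta>
  proof (cases "b = \<alpha>")
    case False
    have "vge u (min \<delta> (u (\<beta> - b))) ((\<alpha> - \<beta>) + (\<beta> - b))"
      using that by (intro vge_add) (auto simp: vge_def min_le_iff_disj)
    then have "min \<delta> (u (\<beta> - b)) \<le> u (\<alpha> - b)"
      using False by (simp add: vge_def)
    then show ?thesis
      using False that by (auto simp: mono_val_linear[OF \<delta>] vge_def val_minus_commute)
  qed (simp add: mono_val_linear[OF \<delta>])
  have "vge u \<delta> (\<alpha> - \<beta>)"
    using ball by (metis minus_diff_eq vge_minus)
  then show "mono_val u \<beta> \<delta> [:- b, 1:] = mono_val u \<alpha> \<delta> [:- b, 1:]" for b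
    using le ball by (simp add: antisym)
qed

text \<open>Testing equal monomial valuations on \<open>X - \<beta>\<close> and
  \<open>X - \<alpha>\<close> recovers the radius and bounds the distance of the centres.\<close>

lemma U_ad_eq_iff:
  assumes \<delta>: "\<delta> \<in> value_group u" and \<delta>': "\<delta>' \<in> value_group u"
  shows "U_ad u \<beta> \<delta> = U_ad u \<alpha> \<delta>' \<longleftrightarrow> \<delta> = \<delta>' \<and> vge u \<delta> (\<beta> - \<alpha>)"
proof
  assume "\<delta> = \<delta>' \<and> vge u \<delta> (\<beta> - \<alpha>)"
  then show "U_ad u \<beta> \<delta> = U_ad u \<alpha> \<delta>'"
    unfolding U_ad_eq_ring_of using mono_val_ball[OF \<delta>] by (auto intro!: ring_of_cong)
next
  assume "U_ad u \<beta> \<delta> = U_ad u \<alpha> \<delta>'"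
  then have eq: "mono_val u \<beta> \<delta> p = mono_val u \<alpha> \<delta>' p" if "p \<noteq> 0" for p
    unfolding U_ad_eq_ring_of
    using ring_of_inject[OF poly_val_mono_val[OF \<delta>] mono_val_attained[OF \<delta>]
        poly_val_mono_val[OF \<delta>'] _ that] by blast
  have 1: "mono_val u \<beta> \<delta> [:- \<beta>, 1:] = mono_val u \<alpha> \<delta>' [:- \<beta>, 1:]"
    "mono_val u \<beta> \<delta> [:- \<alpha>, 1:] = mono_val u \<alpha> \<delta>' [:- \<alpha>, 1:]"
    by (simp_all add: eq)
  then show "\<delta> = \<delta>' \<and> vge u \<delta> (\<beta> - \<alpha>)"
    using \<delta> \<delta>' by (auto simp: mono_val_linear vge_def val_minus_commute min_def split: if_splits)
qed

section \<open>Galois conjugation of monomial valuations\<close>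

lemma gal_inj: "\<sigma> \<in> gal K \<Longrightarrow> \<sigma> x = \<sigma> y \<longleftrightarrow> x = y"
  by (auto simp: gal_def bij_def inj_eq)

lemma gal_0:
  assumes "\<sigma> \<in> gal K"
  shows "\<sigma> 0 = 0"
proof -
  have "\<sigma> (0 + 0) = \<sigma> 0 + \<sigma> 0"
    using assms unfolding gal_def by blast
  then show ?thesis
    by (metis add_0 add_cancel_right_right)
qed

lemma gal_eq_0_iff: "\<sigma> \<in> gal K \<Longrightarrow> \<sigma> x = 0 \<longleftrightarrow> x = 0"
  using gal_0[of \<sigma>] gal_inj[of \<sigma> x 0] by simp

lemma gal_hom:
  assumes "\<sigma> \<in> gal K"
  shows "\<sigma> (x + y) = \<sigma> x + \<sigma> y" "\<sigma> (x * y) = \<sigma> x * \<sigma> y" "\<sigma> 1 = 1" "\<sigma> (- x) = - \<sigma> x"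
    "\<sigma> (x - y) = \<sigma> x - \<sigma> y" "\<sigma> (inverse x) = inverse (\<sigma> x)" "\<sigma> (x ^ n) = \<sigma> x ^ n"
    "\<sigma> (sum f S) = (\<Sum>i\<in>S. \<sigma> (f i))" "x \<in> K \<Longrightarrow> \<sigma> x = x"
proof -
  show add: "\<sigma> (x + y) = \<sigma> x + \<sigma> y" and mult: "\<sigma> (x * y) = \<sigma> x * \<sigma> y" and one: "\<sigma> 1 = 1"
    and "x \<in> K \<Longrightarrow> \<sigma> x = x" for x y
    using assms unfolding gal_def by blast+
  show minus: "\<sigma> (- x) = - \<sigma> x" for x
    using add[of x "- x"] gal_0[OF assms] by (simp add: eq_neg_iff_add_eq_0 add.commute)
  show "\<sigma> (x - y) = \<sigma> x - \<sigma> y"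
    using add[of x "- y"] minus by simp
  show "\<sigma> (inverse x) = inverse (\<sigma> x)"
    using mult[of x "inverse x"] one gal_0[OF assms]
    by (cases "x = 0") (auto simp: inverse_unique)
  show "\<sigma> (x ^ n) = \<sigma> x ^ n"
    by (induction n) (auto simp: one mult)
  show "\<sigma> (sum f S) = (\<Sum>i\<in>S. \<sigma> (f i))"
    by (induction S rule: infinite_finite_induct) (auto simp: gal_0[OF assms] add)
qed

lemma decomp_group_gal: "\<sigma> \<in> decomp_group K u \<Longrightarrow> \<sigma> \<in> gal K"
  by (simp add: decomp_group_def)

text \<open>By definition only the ring is preserved. For the values, pass to a unit
  \<open>x ^ k * inverse c\<close> with \<open>c\<close> in \<open>K\<close>: its image is again a
  unit, and \<open>c\<close> is fixed by \<open>\<sigma>\<close>.\<close>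

lemma decomp_group_val:
  assumes "\<sigma> \<in> decomp_group K u" "x \<noteq> 0"
  shows "u (\<sigma> x) = u x"
proof -
  note \<sigma> = decomp_group_gal[OF assms(1)]
  obtain k c where kc: "0 < k" "c \<in> K" "c \<noteq> 0" "gmul k (u x) = u c"
    using torsion_over[OF assms(2)] by blast
  have "\<sigma> x \<noteq> 0"
    using assms(2) gal_eq_0_iff[OF \<sigma>] by blast
  let ?y = "x ^ k * inverse c"
  have y: "?y \<noteq> 0" "u ?y = 0"
    using kc assms(2) by (auto simp: val_mult val_power val_inverse)
  then have "?y \<in> val_ring u" "inverse ?y \<in> val_ring u"
    using val_inverse[OF y(1)] by (auto simp: val_ring_def)
  then have mem: "\<sigma> ?y \<in> val_ring u" "\<sigma> (inverse ?y) \<in> val_ring u"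
    using assms(1) unfolding decomp_group_def by blast+
  have "\<sigma> ?y \<noteq> 0" "\<sigma> (inverse ?y) = inverse (\<sigma> ?y)"
    using y(1) gal_eq_0_iff[OF \<sigma>] gal_hom(6)[OF \<sigma>] by blast+
  then have "0 \<le> u (\<sigma> ?y)" "0 \<le> - u (\<sigma> ?y)"
    using mem val_inverse[of "\<sigma> ?y"] unfolding val_ring_def by auto
  then have "u (\<sigma> ?y) = 0"
    by simp
  moreover have "\<sigma> ?y = \<sigma> x ^ k * inverse c"
    using kc(2) by (simp add: gal_hom[OF \<sigma>])
  ultimately have "gmul k (u (\<sigma> x)) = u c"
    using kc \<open>\<sigma> x \<noteq> 0\<close> by (simp add: val_mult val_power val_inverse)
  then show ?thesis
    using kc gmul_inject by metis
qed

lemma map_poly_gal: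
  assumes \<sigma>: "\<sigma> \<in> gal K"
  shows "map_poly \<sigma> (p + q) = map_poly \<sigma> p + map_poly \<sigma> q"
    "map_poly \<sigma> (p * q) = map_poly \<sigma> p * map_poly \<sigma> q"
    "map_poly \<sigma> p = 0 \<longleftrightarrow> p = 0"
    "over p \<Longrightarrow> map_poly \<sigma> p = p"
    "map_poly \<sigma> (pCons a p) = pCons (\<sigma> a) (map_poly \<sigma> p)"
    "\<exists>q. map_poly \<sigma> q = p"
proof -
  note [simp] = coeff_map_poly[of \<sigma>, OF gal_0[OF \<sigma>]]
  show "map_poly \<sigma> (p + q) = map_poly \<sigma> p + map_poly \<sigma> q"
    by (rule poly_eqI) (simp add: gal_hom[OF \<sigma>])
  show "map_poly \<sigma> (p * q) = map_poly \<sigma> p * map_poly \<sigma> q"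
    by (rule poly_eqI) (simp add: gal_hom[OF \<sigma>] coeff_mult)
  show "map_poly \<sigma> p = 0 \<longleftrightarrow> p = 0"
    by (simp add: poly_eq_iff gal_eq_0_iff[OF \<sigma>])
  show "over p \<Longrightarrow> map_poly \<sigma> p = p"
    by (rule poly_eqI) (simp add: gal_hom[OF \<sigma>] over_def)
  show pC: "map_poly \<sigma> (pCons a p) = pCons (\<sigma> a) (map_poly \<sigma> p)" for a p
    by (rule map_poly_pCons) (rule gal_0[OF \<sigma>])
  show "\<exists>q. map_poly \<sigma> q = p"
  proof (induction p)
    case (pCons a p)
    have "a \<in> range \<sigma>"
      using \<sigma> by (auto simp: gal_def bij_def)
    then obtain b where b: "a = \<sigma> b"
      by blast
    obtain q where "map_poly \<sigma> q = p"
      using pCons.IH by blast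
    then show ?case
      using pC[of b q] b by auto
  qed (use map_poly_0 in blast)
qed

text \<open>As functions of \<open>p\<close> both sides are valuations, so they need comparing on
  \<open>X - b\<close> only, where \<open>\<sigma>\<close> preserves
  \<open>u (\<alpha> - b)\<close>.\<close>

lemma mono_val_map_poly:
  assumes \<sigma>: "\<sigma> \<in> decomp_group K u" and \<delta>: "\<delta> \<in> value_group u" and p: "p \<noteq> 0"
  shows "mono_val u (\<sigma> \<alpha>) \<delta> (map_poly \<sigma> p) = mono_val u \<alpha> \<delta> p"
proof -
  note g = decomp_group_gal[OF \<sigma>]
  have "poly_val u (\<lambda>p. mono_val u (\<sigma> \<alpha>) \<delta> (map_poly \<sigma> p))"
    unfolding poly_val_def
  proof (intro conjI allI impI)
    interpret poly_valuation u "mono_val u (\<sigma> \<alpha>) \<delta>"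
      by (rule poly_valuation_mono_val[OF \<delta>])
    let ?w = "\<lambda>p. mono_val u (\<sigma> \<alpha>) \<delta> (map_poly \<sigma> p)"
    fix p q :: "'k poly" assume "p \<noteq> 0" "q \<noteq> 0"
    then have nz: "map_poly \<sigma> p \<noteq> 0" "map_poly \<sigma> q \<noteq> 0"
      using map_poly_gal(3)[OF g] by blast+
    show "?w (p * q) = ?w p + ?w q"
      unfolding map_poly_gal(2)[OF g] by (rule pv_mult[OF nz])
    assume "p + q \<noteq> 0"
    then have "map_poly \<sigma> p + map_poly \<sigma> q \<noteq> 0"
      using map_poly_gal(1,3)[OF g] by metis
    then show "min (?w p) (?w q) \<le> ?w (p + q)"
      unfolding map_poly_gal(1)[OF g] by (rule pv_add[OF nz])
  next
    interpret poly_valuation u "mono_val u (\<sigma> \<alpha>) \<delta>"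
      by (rule poly_valuation_mono_val[OF \<delta>])
    fix c :: 'k assume "c \<noteq> 0"
    then show "mono_val u (\<sigma> \<alpha>) \<delta> (map_poly \<sigma> [:c:]) = u c"
      by (simp add: map_poly_gal(5)[OF g] gal_eq_0_iff[OF g] decomp_group_val[OF \<sigma>])
  qed
  moreover have "mono_val u (\<sigma> \<alpha>) \<delta> (map_poly \<sigma> [:- b, 1:]) = mono_val u \<alpha> \<delta> [:- b, 1:]" for b
  proof -
    have "map_poly \<sigma> [:- b, 1:] = [:- \<sigma> b, 1:]"
      by (simp add: map_poly_gal[OF g] gal_hom[OF g])
    moreover have "\<sigma> b = \<sigma> \<alpha> \<longleftrightarrow> b = \<alpha>"
      using gal_inj[OF g] by blast
    moreover have "u (\<sigma> \<alpha> - \<sigma> b) = u (\<alpha> - b)" if "b \<noteq> \<alpha>"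
      using decomp_group_val[OF \<sigma>, of "\<alpha> - b"] that by (simp add: gal_hom[OF g])
    ultimately show ?thesis
      by (simp add: mono_val_linear[OF \<delta>])
  qed
  ultimately show ?thesis
    using poly_val_eq[OF _ poly_val_mono_val[OF \<delta>] _ p] by blast
qed

lemma gal_img_U_ad:
  assumes \<sigma>: "\<sigma> \<in> decomp_group K u" and \<delta>: "\<delta> \<in> value_group u"
  shows "gal_img \<sigma> (U_ad u \<alpha> \<delta>) = U_ad u (\<sigma> \<alpha>) \<delta>"
proof -
  note g = decomp_group_gal[OF \<sigma>]
  interpret w: poly_valuation u "mono_val u \<alpha> \<delta>"
    by (rule poly_valuation_mono_val[OF \<delta>])
  interpret w': poly_valuation u "mono_val u (\<sigma> \<alpha>) \<delta>"
    by (rule poly_valuation_mono_val[OF \<delta>])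
  have iff: "Fract (map_poly \<sigma> p) (map_poly \<sigma> q) \<in> U_ad u (\<sigma> \<alpha>) \<delta> \<longleftrightarrow> Fract p q \<in> U_ad u \<alpha> \<delta>"
    if "q \<noteq> 0" for p q
    unfolding U_ad_eq_ring_of using that
    by (cases "p = 0") (auto simp: w.Fract_in_ring_of w'.Fract_in_ring_of map_poly_gal[OF g] mono_val_map_poly[OF \<sigma> \<delta>])
  show ?thesis
  proof
    show "gal_img \<sigma> (U_ad u \<alpha> \<delta>) \<subseteq> U_ad u (\<sigma> \<alpha>) \<delta>"
      unfolding gal_img_def using iff by auto
    show "U_ad u (\<sigma> \<alpha>) \<delta> \<subseteq> gal_img \<sigma> (U_ad u \<alpha> \<delta>)"
    proof
      fix x assume x: "x \<in> U_ad u (\<sigma> \<alpha>) \<delta>"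
      obtain p' q' where x': "x = Fract p' q'" "q' \<noteq> 0"
        by (cases x)
      obtain p q where pq: "map_poly \<sigma> p = p'" "map_poly \<sigma> q = q'"
        using map_poly_gal(6)[OF g] by metis
      then have "q \<noteq> 0"
        using map_poly_gal(3)[OF g] x'(2) by blast
      then show "x \<in> gal_img \<sigma> (U_ad u \<alpha> \<delta>)"
        unfolding gal_img_def using iff x x' pq by auto
    qed
  qed
qed

lemma U_ad_Int_ratfun_over:
  assumes \<sigma>: "\<sigma> \<in> decomp_group K u" and \<delta>: "\<delta> \<in> value_group u"
  shows "U_ad u (\<sigma> \<alpha>) \<delta> \<inter> ratfun_over K = U_ad u \<alpha> \<delta> \<inter> ratfun_over K"
proof -
  note g = decomp_group_gal[OF \<sigma>]
  interpret w: poly_valuation u "mono_val u \<alpha> \<delta>"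
    by (rule poly_valuation_mono_val[OF \<delta>])
  interpret w': poly_valuation u "mono_val u (\<sigma> \<alpha>) \<delta>"
    by (rule poly_valuation_mono_val[OF \<delta>])
  have "mono_val u (\<sigma> \<alpha>) \<delta> p = mono_val u \<alpha> \<delta> p" if "over p" "p \<noteq> 0" for p
    using mono_val_map_poly[OF \<sigma> \<delta> that(2)] map_poly_gal(4)[OF g that(1)] by metis
  then have "Fract p q \<in> U_ad u (\<sigma> \<alpha>) \<delta> \<longleftrightarrow> Fract p q \<in> U_ad u \<alpha> \<delta>" if "over p" "over q" "q \<noteq> 0" for p q
    unfolding U_ad_eq_ring_of using that
    by (cases "p = 0") (auto simp: w.Fract_in_ring_of w'.Fract_in_ring_of)
  then show ?thesis
    unfolding ratfun_over_def over_def[symmetric] by blast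
qed

end

section \<open>Extensions of the restricted valuation ring\<close>

text \<open>A valuation ring taken abstractly, with no valuation given; that a quotient lies in
  \<open>units\<close> takes the place of equality of values.\<close>

locale val_domain =
  fixes R :: "'a::field set"
  assumes val_domain: "is_valuation_domain R"
begin

definition units :: "'a set" where
  "units = {x. x \<noteq> 0 \<and> x \<in> R \<and> inverse x \<in> R}"

lemma R_one: "1 \<in> R" and R_zero: "0 \<in> R"
  and R_add: "x \<in> R \<Longrightarrow> y \<in> R \<Longrightarrow> x + y \<in> R"
  and R_diff: "x \<in> R \<Longrightarrow> y \<in> R \<Longrightarrow> x - y \<in> R"
  and R_mult: "x \<in> R \<Longrightarrow> y \<in> R \<Longrightarrow> x * y \<in> R"
  and R_total: "x \<noteq> 0 \<Longrightarrow> x \<in> R \<or> inverse x \<in> R"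
  using val_domain unfolding is_valuation_domain_def by blast+

lemma R_power: "x \<in> R \<Longrightarrow> x ^ n \<in> R"
  by (induction n) (auto intro: R_one R_mult)

lemma units_mult: "x \<in> units \<Longrightarrow> y \<in> units \<Longrightarrow> x * y \<in> units"
  by (auto simp: units_def R_mult)

lemma units_inverse: "x \<in> units \<Longrightarrow> inverse x \<in> units"
  by (auto simp: units_def)

lemma units_divide: "x \<in> units \<Longrightarrow> y \<in> units \<Longrightarrow> x / y \<in> units"
  by (simp add: divide_inverse units_mult units_inverse)

lemma units_power: "x \<in> units \<Longrightarrow> x ^ n \<in> units"
  by (auto simp: units_def R_power power_inverse[symmetric])

lemma R_root:
  assumes "x ^ n \<in> R" "0 < n"
  shows "x \<in> R"
proof (rule ccontr)
  assume x: "x \<notin> R"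
  then have "x \<noteq> 0"
    using R_zero by blast
  then have "inverse x \<in> R"
    using x R_total by blast
  then have "x ^ n * inverse x ^ (n - 1) \<in> R"
    using R_mult[OF assms(1)] R_power by blast
  moreover have "x ^ n * inverse x ^ (n - 1) = x * (x * inverse x) ^ (n - 1)"
    using assms(2) by (cases n) (auto simp: power_mult_distrib)
  then have "x ^ n * inverse x ^ (n - 1) = x"
    using \<open>x \<noteq> 0\<close> by simp
  ultimately show False
    using x by simp
qed

lemma units_root:
  assumes "x ^ n \<in> units" "0 < n"
  shows "x \<in> units"
proof -
  have "x \<noteq> 0" "inverse x ^ n \<in> R" "x ^ n \<in> R"
    using assms by (auto simp: units_def power_inverse power_0_left split: if_splits)
  then show ?thesis
    using R_root assms(2) unfolding units_def by blast
qed

text \<open>Of two nonzero elements one divides the other. If \<open>a / b\<close> lies in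
  \<open>R\<close> and \<open>a + b\<close> is a unit, then
  \<open>inverse b = (a / b + 1) * inverse (a + b)\<close> lies in \<open>R\<close>.\<close>

lemma nonunit_add:
  assumes "a \<in> R" "b \<in> R" "a \<notin> units" "b \<notin> units"
  shows "a + b \<notin> units"
proof -
  have *: "a + b \<notin> units" if "a / b \<in> R" "b \<noteq> 0" "b \<in> R" "b \<notin> units" for a b
  proof
    assume unit: "a + b \<in> units"
    then have "(a / b + 1) * inverse (a + b) \<in> R"
      using that(1) R_one by (intro R_mult R_add) (auto simp: units_def)
    moreover have "(a / b + 1) * inverse (a + b) = inverse b"
      using that(2) unit by (simp add: units_def field_simps)
    ultimately show False
      using that by (simp add: units_def)
  qed
  show ?thesis
  proof (cases "a = 0 \<or> b = 0")
    case False
    then have "a / b \<in> R \<or> b / a \<in> R"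
      using R_total[of "a / b"] by simp
    then show ?thesis
      using *[of a b] *[of b a] assms False by (auto simp: add.commute)
  qed (use assms in auto)
qed

lemma nonunit_sum:
  "(\<And>i. i \<in> S \<Longrightarrow> f i \<in> R \<and> f i \<notin> units) \<Longrightarrow> sum f S \<in> R \<and> sum f S \<notin> units"
proof (induction S rule: infinite_finite_induct)
  case (insert x F)
  then have "f x + sum f F \<in> R \<and> f x + sum f F \<notin> units"
    using R_add nonunit_add by blast
  then show ?case
    using insert.hyps by simp
qed (auto simp: R_zero units_def)

text \<open>The counterpart of \<open>val_torsion\<close> for a ring without a given valuation.
  Dividing by a term \<open>t i\<close> that divides all the others, the remaining quotients sum to
  \<open>- 1\<close>, so they cannot all be non-units.\<close>

lemma ex_unit_quotient:
  assumes fin: "finite I" and ne: "I \<noteq> {}" and nz: "\<And>i. i \<in> I \<Longrightarrow> t i \<noteq> 0" and sum: "sum t I = 0"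
  shows "\<exists>i\<in>I. \<exists>j\<in>I. i \<noteq> j \<and> t i / t j \<in> units"
proof (rule ccontr)
  assume neg: "\<not> ?thesis"
  have "\<exists>i\<in>I. \<forall>j\<in>I. t j / t i \<in> R"
    using fin ne nz
  proof (induction I rule: finite_ne_induct)
    case (insert x F)
    then obtain i where i: "i \<in> F" "\<forall>j\<in>F. t j / t i \<in> R"
      by blast
    show ?case
    proof (cases "t x / t i \<in> R")
      case True
      then show ?thesis
        using i by blast
    next
      case False
      then have x: "t i / t x \<in> R"
        using R_total[of "t x / t i"] insert.prems i(1) by force
      have "t j / t x \<in> R" if "j \<in> F" for j
      proof -
        have "(t j / t i) * (t i / t x) \<in> R"
          using i(2) that x by (intro R_mult) auto
        then show ?thesis
          using insert.prems i(1) by force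
      qed
      then show ?thesis
        using insert.prems R_one by auto
    qed
  qed (use R_one in auto)
  then obtain i where i: "i \<in> I" "\<And>j. j \<in> I \<Longrightarrow> t j / t i \<in> R"
    by blast
  have "(\<Sum>j\<in>I - {i}. t j / t i) \<notin> units"
    using nonunit_sum[of "I - {i}" "\<lambda>j. t j / t i"] i neg by blast
  moreover have "(\<Sum>j\<in>I - {i}. t j / t i) = - 1"
    using sum nz[OF i(1)] sum.remove[OF fin i(1), of t]
    by (simp add: sum_divide_distrib[symmetric] field_simps eq_neg_iff_add_eq_0 add.commute)
  moreover have "- 1 \<in> units"
    using R_diff[OF R_zero R_one] by (simp add: units_def)
  ultimately show False
    by simp
qed

end

lemma pcompose_const_right: "pcompose p [:b:] = [:poly p b:]"
  by (induction p) (auto simp: pcompose_pCons mult.commute)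

section \<open>The polynomial ring inside its field of fractions\<close>

definition emb :: "'k::field poly \<Rightarrow> 'k poly fract" where
  "emb p = Fract p 1"

lemma emb_0 [simp]: "emb 0 = 0" and emb_1 [simp]: "emb 1 = 1"
  and emb_add: "emb (p + q) = emb p + emb q"
  and emb_mult: "emb (p * q) = emb p * emb q"
  and emb_eq_0_iff [simp]: "emb p = 0 \<longleftrightarrow> p = 0"
  and const_fr_eq_emb: "const_fr c = emb [:c:]"
  by (simp_all add: emb_def const_fr_def Zero_fract_def One_fract_def eq_fract)

lemma emb_power: "emb (p ^ n) = emb p ^ n"
  by (induction n) (auto simp: emb_mult)

lemma emb_sum: "emb (sum f S) = (\<Sum>i\<in>S. emb (f i))"
  by (induction S rule: infinite_finite_induct) (auto simp: emb_add)

lemma Fract_eq_emb: "q \<noteq> 0 \<Longrightarrow> Fract p q = emb p / emb q"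
  by (simp add: emb_def)

lemma const_fr_mult: "const_fr (c * d) = const_fr c * const_fr d"
  by (simp add: const_fr_def mult.commute)

lemma const_fr_1 [simp]: "const_fr 1 = 1"
  by (simp add: const_fr_def One_fract_def one_pCons)

lemma const_fr_eq_0_iff [simp]: "const_fr c = 0 \<longleftrightarrow> c = 0"
  by (simp add: const_fr_eq_emb)

lemma const_fr_inverse: "const_fr (inverse c) = inverse (const_fr c)"
proof (cases "c = 0")
  case False
  then have "const_fr c * const_fr (inverse c) = 1"
    by (simp flip: const_fr_mult)
  then show ?thesis
    by (metis inverse_unique)
qed (metis const_fr_eq_0_iff inverse_zero)

lemma const_fr_divide: "const_fr (c / d) = const_fr c / const_fr d"
  by (simp add: divide_inverse const_fr_mult const_fr_inverse)

lemma const_fr_power: "const_fr (c ^ n) = const_fr c ^ n"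
  by (induction n) (auto simp: const_fr_mult)

context alg_closure
begin

lemma over_add: "over p \<Longrightarrow> over q \<Longrightarrow> over (p + q)"
  and over_diff: "over p \<Longrightarrow> over q \<Longrightarrow> over (p - q)"
  and over_mult: "over p \<Longrightarrow> over q \<Longrightarrow> over (p * q)"
  and over_pcompose: "over p \<Longrightarrow> over q \<Longrightarrow> over (pcompose p q)"
  and over_power: "over p \<Longrightarrow> over (p ^ n)"
  and over_pCons: "a \<in> K \<Longrightarrow> over p \<Longrightarrow> over (pCons a p)"
  and over_0: "over 0" and over_1: "over 1"
proof -
  interpret field_graph "Id_on K"
    by (rule field_graph_diag)
  show "over p \<Longrightarrow> over q \<Longrightarrow> over (p + q)" "over p \<Longrightarrow> over q \<Longrightarrow> over (p - q)"
    "over p \<Longrightarrow> over q \<Longrightarrow> over (p * q)" "over p \<Longrightarrow> over q \<Longrightarrow> over (pcompose p q)"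
    "over p \<Longrightarrow> over (p ^ n)" "a \<in> K \<Longrightarrow> over p \<Longrightarrow> over (pCons a p)" "over 0" "over 1"
    using polyrel_add[of p p q q] polyrel_diff[of p p q q] polyrel_mult[of p p q q]
      polyrel_pcompose[of p p q q] polyrel_power[of p p n] polyrel_pCons[of a a p p]
      polyrel_0 polyrel_1
    unfolding polyrel_diag by blast+
qed

lemma over_const: "c \<in> K \<Longrightarrow> over [:c:]"
  by (intro over_pCons over_0)

lemma over_root_power:
  assumes "0 < n"
  shows "\<exists>e. e ^ n = (c :: 'k)"
proof -
  have "degree (monom 1 n + [:- c:]) = n"
    using assms by (subst degree_add_eq_left) (auto simp: degree_monom_eq)
  then obtain e where "poly (monom 1 n + [:- c:]) e = 0"
    using root_exists[of "monom 1 n + [:- c:]"] assms by auto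
  then show ?thesis
    by (intro exI[of _ e]) (simp add: poly_monom)
qed

text \<open>The polynomial \<open>C\<close> in \<open>T\<close> witnesses that \<open>X - b\<close> is algebraic over \<open>K(X)\<close>: substitute \<open>X - T\<close> into a
  polynomial over \<open>K\<close> that vanishes at \<open>b\<close>.\<close>

lemma ex_difference_poly:
  "over N \<Longrightarrow> \<exists>C. (\<forall>j. over (coeff C j)) \<and> (\<forall>x. poly C x = pcompose N ([:0, 1:] - x))"
proof (induction N)
  case 0
  then show ?case
    by (intro exI[of _ 0]) (simp add: over_0)
next
  case (pCons a N)
  have a: "a \<in> K" and N: "over N"
    using pCons.prems unfolding over_def by (metis coeff_pCons_0, metis coeff_pCons_Suc)
  obtain C where C: "\<And>j. over (coeff C j)" "\<And>x. poly C x = pcompose N ([:0, 1:] - x)"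
    using pCons.IH[OF N] by blast
  have X: "over [:0, 1:]"
    using subfield by (intro over_pCons over_0) (auto simp: is_subfield_def)
  \<comment> \<open>This is \<open>a + (X - T) C\<close>: \<open>smult [:0, 1:]\<close> multiplies
    by \<open>X\<close>, and \<open>pCons 0\<close> by \<open>T\<close>.\<close>
  let ?C = "[:[:a:]:] + (smult [:0, 1:] C - pCons 0 C)"
  have "over (coeff ?C j)" for j
    unfolding coeff_add coeff_diff coeff_smult
    by (intro over_add over_diff over_mult X C)
      (auto simp: coeff_pCons over_const[OF a] over_0 C(1) split: nat.split)
  moreover have "poly ?C x = pcompose (pCons a N) ([:0, 1:] - x)" for x
    by (simp only: pcompose_pCons C(2)[symmetric]) (simp add: algebra_simps)
  ultimately show ?case
    by blast
qed

end

text \<open>\<open>R\<close> is an arbitrary extension of the restricted ring above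
  \<open>U\<close>. Only its elements over \<open>K\<close> and its constants are known at first;
  \<open>ex_poly_val\<close> constructs a valuation for it.\<close>

locale extension = valued_closure K u + val_domain R
  for K :: "'k::field set" and u :: "'k \<Rightarrow> 'g::linordered_ab_group_add" and R :: "'k poly fract set" +
  fixes \<alpha> :: 'k and \<delta> :: 'g
  assumes \<delta>: "\<delta> \<in> value_group u"
    and R_over: "R \<inter> ratfun_over K = U_ad u \<alpha> \<delta> \<inter> ratfun_over K"
    and R_const: "{c. const_fr c \<in> R} = val_ring u"
begin

sublocale mono: poly_valuation u "mono_val u \<alpha> \<delta>"
  by (rule poly_valuation_mono_val[OF \<delta>])

lemma const_fr_in_R: "const_fr c \<in> R \<longleftrightarrow> c = 0 \<or> 0 \<le> u c"
  using R_const unfolding val_ring_def by blast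

lemma const_fr_in_units: "c \<noteq> 0 \<Longrightarrow> const_fr c \<in> units \<longleftrightarrow> u c = 0"
  by (auto simp: units_def const_fr_in_R val_inverse simp flip: const_fr_inverse)

lemma over_fract_in_units:
  assumes "over p" "p \<noteq> 0" "over q" "q \<noteq> 0" "mono_val u \<alpha> \<delta> p = mono_val u \<alpha> \<delta> q"
  shows "emb p / emb q \<in> units"
proof -
  have "Fract p q \<in> U_ad u \<alpha> \<delta>" "Fract q p \<in> U_ad u \<alpha> \<delta>"
    using assms unfolding U_ad_eq_ring_of by (simp_all add: mono.Fract_in_ring_of)
  moreover have "Fract p q \<in> ratfun_over K" "Fract q p \<in> ratfun_over K"
    using assms unfolding ratfun_over_def over_def by blast+
  ultimately have "Fract p q \<in> R" "Fract q p \<in> R"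
    using R_over by blast+
  then show ?thesis
    using assms by (simp add: units_def Fract_eq_emb)
qed

text \<open>Monomial values are values of \<open>u\<close>, hence torsion modulo those of
  \<open>K\<close>. A power of the quotient therefore matches a constant from \<open>K\<close>, and
  this comparison takes place inside \<open>K(X)\<close>, where \<open>R\<close> is known.\<close>

lemma over_fract_torsion:
  assumes "over p" "p \<noteq> 0" "over q" "q \<noteq> 0"
  shows "\<exists>n c. 0 < n \<and> c \<noteq> 0 \<and> gmul n (mono_val u \<alpha> \<delta> p - mono_val u \<alpha> \<delta> q) = u c \<and>
    (emb p / emb q) ^ n / const_fr c \<in> units"
proof -
  obtain a b where ab: "a \<noteq> 0" "mono_val u \<alpha> \<delta> p = u a" "b \<noteq> 0" "mono_val u \<alpha> \<delta> q = u b"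
    using mono_val_attained[OF \<delta>] assms by metis
  obtain n c where nc: "0 < n" "c \<in> K" "c \<noteq> 0" "gmul n (u (a / b)) = u c"
    using torsion_over[of "a / b"] ab by auto
  have n: "gmul n (u a) = u c + gmul n (u b)"
  proof -
    have "u (a ^ n) = u ((a / b) ^ n * b ^ n)"
      using ab by (simp add: power_divide)
    also have "\<dots> = gmul n (u (a / b)) + gmul n (u b)"
      using ab by (subst val_mult) (auto simp: val_power)
    finally show ?thesis
      unfolding nc(4) val_power[OF ab(1)] .
  qed
  have "mono_val u \<alpha> \<delta> (p ^ n) = mono_val u \<alpha> \<delta> ([:c:] * q ^ n)"
    unfolding mono.pv_power[OF assms(2)] ab(2) n using assms ab nc
    by (simp add: mono.pv_mult mono.pv_smult mono.pv_power)
  then have "emb (p ^ n) / emb ([:c:] * q ^ n) \<in> units"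
    using assms nc by (intro over_fract_in_units over_mult over_power over_const) auto
  then have "(emb p / emb q) ^ n / const_fr c \<in> units"
    unfolding emb_mult emb_power const_fr_eq_emb by (simp add: power_divide mult.commute)
  then show ?thesis
    using nc ab by (auto simp: val_divide)
qed

text \<open>As \<open>X - b\<close> is a root of \<open>C\<close>, two terms of \<open>C\<close> at
  \<open>X - b\<close> differ by a unit factor. So a power of \<open>X - b\<close> agrees up to a
  unit with a quotient of polynomials over \<open>K\<close>, and a further power with a constant
  \<open>c\<close>; a root of \<open>c\<close> of the right order exists by algebraic
  closedness.\<close>

lemma linear_unit: "\<exists>c. c \<noteq> 0 \<and> emb [:- b, 1:] / const_fr c \<in> units"
proof -
  define f :: "'k poly" where "f = [:- b, 1:]"
  obtain N where N: "over N" "N \<noteq> 0" "poly N b = 0"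
    using ex_over_root by blast
  obtain C where C: "\<And>j. over (coeff C j)" "\<And>x. poly C x = pcompose N ([:0, 1:] - x)"
    using ex_difference_poly[OF N(1)] by blast
  have Cf: "poly C f = 0"
  proof -
    have "[:0, 1:] - f = [:b:]"
      by (simp add: f_def)
    then show ?thesis
      using N(3) by (simp add: C(2) pcompose_const_right)
  qed
  have "poly C 0 = N"
    by (simp add: C(2) pcompose_idR)
  then have "C \<noteq> 0"
    using N(2) by auto
  define I where "I = {j. coeff C j \<noteq> 0}"
  define t where "t j = emb (coeff C j * f ^ j)" for j
  have "f \<noteq> 0"
    by (simp add: f_def)
  have fin: "finite I"
    unfolding I_def by (rule finite_subset[of _ "{..degree C}"]) (auto simp: le_degree)
  have "I \<noteq> {}"
    using \<open>C \<noteq> 0\<close> by (auto simp: I_def poly_eq_iff)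
  moreover have "sum t I = emb (\<Sum>j\<le>degree C. coeff C j * f ^ j)"
    unfolding emb_sum t_def
    by (rule sum.mono_neutral_left) (auto simp: I_def le_degree)
  then have "sum t I = 0"
    using Cf by (simp add: poly_altdef)
  ultimately obtain i j where ij: "i \<in> I" "j \<in> I" "i \<noteq> j" "t i / t j \<in> units"
    using ex_unit_quotient[OF fin, of t] \<open>f \<noteq> 0\<close> by (auto simp: t_def I_def)
  obtain i j where ij: "i \<in> I" "j \<in> I" "i < j" "t j / t i \<in> units"
  proof (cases "i < j")
    case True
    then show ?thesis
      using that[of i j] ij units_inverse[OF ij(4)] by simp
  next
    case False
    then show ?thesis
      using that[of j i] ij by simp
  qed
  define k where "k = j - i"
  have k: "0 < k" "j = k + i"
    using ij(3) by (auto simp: k_def)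
  let ?g = "emb f" and ?ci = "emb (coeff C i)" and ?cj = "emb (coeff C j)"
  have nz: "?g \<noteq> 0" "?ci \<noteq> 0" "?cj \<noteq> 0"
    using \<open>f \<noteq> 0\<close> ij by (auto simp: I_def)
  have "t j / t i = ?g ^ k * (?cj / ?ci)"
    using nz by (simp add: t_def emb_mult emb_power k(2) power_add field_simps)
  then have 1: "?g ^ k * (?cj / ?ci) \<in> units"
    using ij by simp
  obtain n c where nc: "0 < n" "c \<noteq> 0" "(?ci / ?cj) ^ n / const_fr c \<in> units"
    using over_fract_torsion[of "coeff C i" "coeff C j"] ij C(1) by (auto simp: I_def)
  obtain e where e: "e ^ (k * n) = c"
    using over_root_power[of "k * n" c] k nc by auto
  have "(?g ^ k * (?cj / ?ci)) ^ n * ((?ci / ?cj) ^ n / const_fr c) \<in> units"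
    by (intro units_mult units_power 1 nc)
  also have "(?g ^ k * (?cj / ?ci)) ^ n * ((?ci / ?cj) ^ n / const_fr c) = (?g / const_fr e) ^ (k * n)"
    using nz nc(2) unfolding e[symmetric]
    by (simp add: power_mult_distrib power_divide const_fr_power field_simps flip: power_mult)
  finally have "?g / const_fr e \<in> units"
    using units_root k nc by simp
  moreover have "e \<noteq> 0"
    using e nc(2) k nc(1) by auto
  ultimately show ?thesis
    unfolding f_def by blast
qed

lemma poly_unit: "p \<noteq> 0 \<Longrightarrow> \<exists>c. c \<noteq> 0 \<and> emb p / const_fr c \<in> units"
proof (induction p rule: poly_induct_linear)
  case (const c)
  then have "emb [:c:] / const_fr c = const_fr 1"
    by (simp add: const_fr_eq_emb flip: one_pCons)
  then show ?case
    using const const_fr_in_units[of 1] by (intro exI[of _ c]) simp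
next
  case (linear b)
  then show ?case
    by (rule linear_unit)
next
  case (mult p q)
  then obtain c d where cd: "c \<noteq> 0" "emb p / const_fr c \<in> units" "d \<noteq> 0" "emb q / const_fr d \<in> units"
    by blast
  then have "(emb p / const_fr c) * (emb q / const_fr d) \<in> units"
    by (intro units_mult)
  then show ?case
    using cd by (intro exI[of _ "c * d"]) (simp add: emb_mult const_fr_mult)
qed

text \<open>Let \<open>w p\<close> be \<open>u c\<close> for a nonzero constant \<open>c\<close>
  with \<open>emb p / const_fr c\<close> a unit. Constants that are units have value 0, so the
  choice of \<open>c\<close> is immaterial. Over \<open>K\<close>, agreement with
  \<open>mono_val\<close> is checked on \<open>n\<close>-th powers.\<close>

lemma ex_poly_val:
  "\<exists>w. poly_val u w \<and> R = ring_of w \<and> (\<forall>p. p \<noteq> 0 \<longrightarrow> (\<exists>c. c \<noteq> 0 \<and> w p = u c)) \<and>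
    (\<forall>p. over p \<longrightarrow> p \<noteq> 0 \<longrightarrow> w p = mono_val u \<alpha> \<delta> p)"
proof -
  define s where "s p = (SOME c. c \<noteq> 0 \<and> emb p / const_fr c \<in> units)" for p
  have s: "s p \<noteq> 0" "emb p / const_fr (s p) \<in> units" if "p \<noteq> 0" for p
    using someI_ex[OF poly_unit[OF that]] unfolding s_def by blast+
  define w where "w p = u (s p)" for p
  have le_iff: "emb p / emb q \<in> R \<longleftrightarrow> w q \<le> w p" if "p \<noteq> 0" "q \<noteq> 0" for p q
  proof -
    have mem: "emb p / const_fr (s p) \<in> R" "const_fr (s p) / emb p \<in> R"
      "emb q / const_fr (s q) \<in> R" "const_fr (s q) / emb q \<in> R"
      using s[OF that(1)] s[OF that(2)] by (auto simp: units_def)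
    have "emb p / emb q \<in> R \<longleftrightarrow> const_fr (s p / s q) \<in> R"
    proof
      assume "emb p / emb q \<in> R"
      then have "const_fr (s p) / emb p * (emb p / emb q * (emb q / const_fr (s q))) \<in> R"
        by (intro R_mult mem)
      then show "const_fr (s p / s q) \<in> R"
        using that by (simp add: const_fr_divide)
    next
      assume "const_fr (s p / s q) \<in> R"
      then have "emb p / const_fr (s p) * (const_fr (s p / s q) * (const_fr (s q) / emb q)) \<in> R"
        by (intro R_mult mem)
      then show "emb p / emb q \<in> R"
        using that s(1) by (simp add: const_fr_divide)
    qed
    also have "\<dots> \<longleftrightarrow> w q \<le> w p"
      using s(1) that by (simp add: const_fr_in_R val_divide w_def)
    finally show ?thesis .
  qed
  have w_eq: "w p = u c" if "p \<noteq> 0" "c \<noteq> 0" "emb p / const_fr c \<in> units" for p c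
  proof -
    have "(emb p / const_fr c) / (emb p / const_fr (s p)) \<in> units"
      using units_divide[OF that(3) s(2)[OF that(1)]] .
    then have "const_fr (s p / c) \<in> units"
      using that by (simp add: const_fr_divide)
    then show ?thesis
      using const_fr_in_units[of "s p / c"] s(1) that by (simp add: val_divide w_def)
  qed
  have "poly_val u w"
    unfolding poly_val_def
  proof (intro conjI allI impI)
    fix p q :: "'k poly" assume pq: "p \<noteq> 0" "q \<noteq> 0"
    have "(emb p / const_fr (s p)) * (emb q / const_fr (s q)) \<in> units"
      using s pq by (intro units_mult)
    then have "w (p * q) = u (s p * s q)"
      using s pq by (intro w_eq) (auto simp: emb_mult const_fr_mult)
    then show "w (p * q) = w p + w q"
      using s pq by (simp add: val_mult w_def)
    assume nz: "p + q \<noteq> 0"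
    have *: "w r \<le> w (p + q)" if r: "r \<noteq> 0" "w r \<le> w p" "w r \<le> w q" for r
    proof -
      have "emb p / emb r + emb q / emb r \<in> R"
        using r pq le_iff by (intro R_add) auto
      then show ?thesis
        using le_iff[OF nz r(1)] by (simp add: emb_add add_divide_distrib)
    qed
    show "min (w p) (w q) \<le> w (p + q)"
      using *[OF pq(1)] *[OF pq(2)] by (cases "w p \<le> w q") auto
  next
    fix c :: 'k assume c: "c \<noteq> 0"
    then have "emb [:c:] / const_fr c = const_fr 1"
      by (simp add: const_fr_eq_emb flip: one_pCons)
    then show "w [:c:] = u c"
      using c const_fr_in_units[of 1] by (intro w_eq) auto
  qed
  moreover have "R = ring_of w"
  proof (rule set_eqI)
    interpret w: poly_valuation u w
      by unfold_locales fact
    fix x :: "'k poly fract"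
    obtain p q where x: "x = Fract p q" "q \<noteq> 0"
      by (cases x)
    have "x \<in> ring_of w \<longleftrightarrow> p = 0 \<or> w q \<le> w p"
      using x w.Fract_in_ring_of by blast
    moreover have "x = emb p / emb q"
      using x Fract_eq_emb by blast
    ultimately show "x \<in> R \<longleftrightarrow> x \<in> ring_of w"
      using le_iff[of p q] R_zero x(2) by (cases "p = 0") auto
  qed
  moreover have "w p = mono_val u \<alpha> \<delta> p" if p: "over p" "p \<noteq> 0" for p
  proof -
    obtain n c where nc: "0 < n" "c \<noteq> 0" "gmul n (mono_val u \<alpha> \<delta> p) = u c" "emb p ^ n / const_fr c \<in> units"
      using over_fract_torsion[OF p over_1] by auto
    have "w (p ^ n) = u c"
      using p nc by (intro w_eq) (auto simp: emb_power)
    moreover have "(emb p / const_fr (s p)) ^ n \<in> units"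
      using s p by (intro units_power)
    then have "w (p ^ n) = u (s p ^ n)"
      using s p by (intro w_eq) (auto simp: emb_power power_divide const_fr_power)
    ultimately have "gmul n (w p) = gmul n (mono_val u \<alpha> \<delta> p)"
      using nc(3) s p by (simp add: val_power w_def)
    then show ?thesis
      using nc(1) gmul_inject by blast
  qed
  ultimately show ?thesis
    using s(1) unfolding w_def by blast
qed

end

section \<open>Conjugacy of the monomial extensions\<close>

context valued_closure
begin

lemma ball_trans: "vge u g (a - b) \<Longrightarrow> vge u g (b - c) \<Longrightarrow> vge u g (a - c)"
  using vge_add[of g "a - b" "b - c"] by simp

text \<open>For \<open>b \<noteq> \<beta>\<close>, the ultrametric inequality between
  \<open>X - b\<close>, \<open>X - \<beta>\<close> and the constant \<open>\<beta> - b\<close>,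
  combined with maximality, forces \<open>X - b\<close> to have the monomial value.\<close>

lemma mono_val_eqI:
  assumes w: "poly_val u w" and \<gamma>: "w [:- \<beta>, 1:] \<in> value_group u"
    and max: "\<And>b. w [:- b, 1:] \<le> w [:- \<beta>, 1:]" and p: "p \<noteq> 0"
  shows "w p = mono_val u \<beta> (w [:- \<beta>, 1:]) p"
proof (rule poly_val_eq[OF w poly_val_mono_val[OF \<gamma>] _ p])
  interpret poly_valuation u w
    by unfold_locales fact
  fix b
  let ?\<gamma> = "w [:- \<beta>, 1:]"
  show "w [:- b, 1:] = mono_val u \<beta> ?\<gamma> [:- b, 1:]"
  proof (cases "b = \<beta>")
    case False
    have eq: "[:- b, 1:] = [:- \<beta>, 1:] + [:\<beta> - b:]" "[:\<beta> - b:] = [:- b, 1:] - [:- \<beta>, 1:]"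
      by simp_all
    have c: "w [:\<beta> - b:] = u (\<beta> - b)"
      using False by simp
    have "min ?\<gamma> (u (\<beta> - b)) \<le> w [:- b, 1:]"
      using pv_add[of "[:- \<beta>, 1:]" "[:\<beta> - b:]"] False unfolding eq(1)[symmetric] c by simp
    moreover have "w [:- b, 1:] \<le> u (\<beta> - b)"
      using pv_diff_ge[of "[:- b, 1:]" "w [:- b, 1:]" "[:- \<beta>, 1:]"] max[of b] False unfolding eq(2)[symmetric] c
      by simp
    ultimately show ?thesis
      using False max[of b] by (simp add: mono_val_linear[OF \<gamma>] antisym)
  qed (simp add: mono_val_linear[OF \<gamma>])
qed

text \<open>The residue of \<open>t\<close> is a nonconstant polynomial in the residue of \<open>(X - \<alpha>) / d\<close>, hence
  transcendental over the residue field of \<open>u\<close>.\<close>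

lemma mono_val_pcompose_eq_gauss:
  assumes \<delta>: "\<delta> \<in> value_group u" and deg: "degree t \<noteq> 0" and t\<alpha>: "poly t \<alpha> = 0"
    and t: "mono_val u \<alpha> \<delta> t = 0" and N: "N \<noteq> 0"
  shows "mono_val u \<alpha> \<delta> (pcompose N t) = gauss u N"
proof (rule poly_val_eq[OF poly_val_pcompose[OF poly_val_mono_val[OF \<delta>] deg] poly_val_gauss _ N])
  fix b
  obtain d where d: "d \<noteq> 0" "\<delta> = u d"
    using \<delta> by (auto simp: value_group_def)
  define h where "h = pcompose t [:\<alpha>, d:]"
  have h: "gauss u h = 0" "coeff h 0 = 0"
    using t t\<alpha> d by (auto simp: h_def mono_val_eq_gauss poly_pcompose simp flip: poly_0_coeff_0)
  have "degree h \<noteq> 0"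
    using deg d by (simp add: h_def degree_pcompose)
  then have "h \<noteq> 0"
    by auto
  have hb: "h - [:b:] \<noteq> 0"
    using \<open>degree h \<noteq> 0\<close> by (metis degree_pCons_0 eq_iff_diff_eq_0)
  have "pcompose [:- b, 1:] t = t - [:b:]"
    by (simp add: pcompose_pCons)
  then have "mono_val u \<alpha> \<delta> (pcompose [:- b, 1:] t) = gauss u (h - [:b:])"
    using d by (simp add: mono_val_eq_gauss h_def pcompose_diff)
  \<comment> \<open>The constant coefficient of \<open>h\<close> is 0, so subtracting
    \<open>b\<close> leaves untouched a coefficient of value 0 elsewhere.\<close>
  also have "\<dots> = gauss u [:- b, 1:]"
  proof -
    obtain i where i: "coeff h i \<noteq> 0" "u (coeff h i) = 0"
      using gauss_attained[OF \<open>h \<noteq> 0\<close>] h(1) by auto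
    then have "coeff (h - [:b:]) i = coeff h i"
      using h(2) by (cases i) auto
    then have "gauss u (h - [:b:]) \<le> 0"
      using gauss_le[OF hb, of i] i by (simp add: vge_def)
    moreover have "b = 0 \<or> gauss u (h - [:b:]) \<le> u b"
      using gauss_le[OF hb, of 0] h(2) by (simp add: vge_def)
    moreover have ge: "g \<le> gauss u (h - [:b:])" if "g \<le> 0" "b = 0 \<or> g \<le> u b" for g
      unfolding gauss_ge_iff[OF hb]
    proof
      fix i
      show "vge u g (coeff (h - [:b:]) i)"
        using gauss_le[OF \<open>h \<noteq> 0\<close>, of i] h that by (cases i) (auto simp: vge_def)
    qed
    have "(if b = 0 then 0 else min 0 (u b)) \<le> gauss u (h - [:b:])"
      by (rule ge) auto
    ultimately show ?thesis
      by (auto simp: gauss_linear simp del: diff_pCons intro!: antisym)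
  qed
  finally show "mono_val u \<alpha> \<delta> (pcompose [:- b, 1:] t) = gauss u [:- b, 1:]" .
qed

text \<open>Since \<open>b\<close> is closer to \<open>X\<close> than every root, each factor
  \<open>X - r\<close> is \<open>b - r\<close> plus a term of larger value, and such approximations
  multiply.\<close>

lemma close_to_value_at_dominating_point:
  assumes w: "poly_val u w" and p: "p \<noteq> 0"
    and roots: "\<And>r. poly p r = 0 \<Longrightarrow> w [:- r, 1:] < w [:- b, 1:]"
  shows "poly p b \<noteq> 0 \<and> w p = u (poly p b) \<and>
    (p - [:poly p b:] = 0 \<or> u (poly p b) < w (p - [:poly p b:]))"
proof -
  interpret poly_valuation u w
    by unfold_locales fact
  show ?thesis
    using p roots
  proof (induction p rule: poly_induct_linear)
    case (linear r)
    have lt: "w [:- r, 1:] < w [:- b, 1:]"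
      using linear[of r] by simp
    then have "r \<noteq> b"
      by auto
    have eq: "[:b - r:] = [:- r, 1:] - [:- b, 1:]" "[:- r, 1:] = [:b - r:] + [:- b, 1:]"
      by simp_all
    have c: "w [:b - r:] = u (b - r)"
      using \<open>r \<noteq> b\<close> by simp
    have "w [:- r, 1:] \<le> u (b - r)"
      using pv_diff_ge[of "[:- r, 1:]" "w [:- r, 1:]" "[:- b, 1:]"] lt \<open>r \<noteq> b\<close>
      unfolding eq(1)[symmetric] c by simp
    moreover have "min (u (b - r)) (w [:- b, 1:]) \<le> w [:- r, 1:]"
      using pv_add[of "[:b - r:]" "[:- b, 1:]"] \<open>r \<noteq> b\<close> unfolding eq(2)[symmetric] c by simp
    ultimately have "w [:- r, 1:] = u (b - r)"
      using lt by (auto simp: min_le_iff_disj)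
    then show ?case
      using lt \<open>r \<noteq> b\<close> by simp
  next
    case (mult p q)
    let ?p = "poly p b" and ?q = "poly q b"
    have P: "?p \<noteq> 0" "w p = u ?p" "p - [:?p:] = 0 \<or> u ?p < w (p - [:?p:])"
      using mult by auto
    have Q: "?q \<noteq> 0" "w q = u ?q" "q - [:?q:] = 0 \<or> u ?q < w (q - [:?q:])"
      using mult by auto
    have 1: "(p - [:?p:]) * q = 0 \<or> u (?p * ?q) < w ((p - [:?p:]) * q)"
      using P Q mult(1,2) by (cases "p - [:?p:] = 0") (auto simp: pv_mult val_mult)
    have 2: "[:?p:] * (q - [:?q:]) = 0 \<or> u (?p * ?q) < w ([:?p:] * (q - [:?q:]))"
      using P Q by (cases "q - [:?q:] = 0") (auto simp: pv_smult val_mult simp del: smult_diff_right)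
    have "(p - [:?p:]) * q + [:?p:] * (q - [:?q:]) = p * q - [:poly (p * q) b:]"
      by (simp add: algebra_simps smult_diff_right)
    then show ?case
      using pv_add_gt[OF 1 2] P Q mult(1,2) by (simp add: pv_mult val_mult)
  qed simp
qed

text \<open>Take a root of \<open>f\<close> that is best among the roots. If some \<open>b\<close>
  did better, a scaled power \<open>t\<close> of \<open>f\<close> would be close to the constant
  \<open>poly t b\<close>, giving it an algebraic residue.\<close>

lemma ex_maximal_root:
  assumes \<delta>: "\<delta> \<in> value_group u" and w: "poly_val u w"
    and w_over: "\<And>p. over p \<Longrightarrow> p \<noteq> 0 \<Longrightarrow> w p = mono_val u \<alpha> \<delta> p"
    and f: "over f" "f \<noteq> 0" "poly f \<alpha> = 0"
  shows "\<exists>\<beta>. poly f \<beta> = 0 \<and> (\<forall>b. w [:- b, 1:] \<le> w [:- \<beta>, 1:])"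
proof -
  interpret poly_valuation u w
    by unfold_locales fact
  let ?S = "{r. poly f r = 0}"
  have "finite ?S" "\<alpha> \<in> ?S"
    using f poly_roots_finite by auto
  then have fin: "finite ((\<lambda>r. w [:- r, 1:]) ` ?S)" "(\<lambda>r. w [:- r, 1:]) ` ?S \<noteq> {}"
    by auto
  then have "Max ((\<lambda>r. w [:- r, 1:]) ` ?S) \<in> (\<lambda>r. w [:- r, 1:]) ` ?S"
    by (rule Max_in)
  then obtain \<beta> where \<beta>: "poly f \<beta> = 0" "w [:- \<beta>, 1:] = Max ((\<lambda>r. w [:- r, 1:]) ` ?S)"
    by auto
  have max: "w [:- r, 1:] \<le> w [:- \<beta>, 1:]" if "poly f r = 0" for r
    unfolding \<beta>(2) using that fin by (intro Max_ge) auto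
  have "w [:- b, 1:] \<le> w [:- \<beta>, 1:]" for b
  proof (rule ccontr)
    assume "\<not> ?thesis"
    then have b: "w [:- r, 1:] < w [:- b, 1:]" if "poly f r = 0" for r
      using max[OF that] by (meson le_less_trans not_le)
    obtain a where a: "a \<noteq> 0" "mono_val u \<alpha> \<delta> f = u a"
      using mono_val_attained[OF \<delta> f(2)] by blast
    obtain n c where nc: "0 < n" "c \<in> K" "c \<noteq> 0" "gmul n (u a) = u c"
      using torsion_over[OF a(1)] by blast
    \<comment> \<open>A power of \<open>f\<close> divided by an element of \<open>K\<close> has
      value 0 and still has its coefficients in \<open>K\<close>, where \<open>w\<close> and the
      monomial valuation agree.\<close>
    define t where "t = smult (inverse c) (f ^ n)"
    have "inverse c \<in> K"
      using nc(2) subfield by (auto simp: is_subfield_def)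
    then have t: "over t" "t \<noteq> 0" "poly t \<alpha> = 0"
      using f nc over_smult[OF _ over_power[OF f(1)]] by (auto simp: t_def)
    have "degree t \<noteq> 0"
    proof
      assume "degree t = 0"
      then obtain a where "t = [:a:]"
        by (rule degree_eq_zeroE)
      then show False
        using t(2,3) by simp
    qed
    have "w t = 0"
      using f a nc w_over[OF f(1,2)] by (simp add: t_def pv_smult pv_power val_inverse)
    then have mt: "mono_val u \<alpha> \<delta> t = 0"
      using w_over t by simp
    define e where "e = poly t b"
    have e: "e \<noteq> 0" "w t = u e" "t - [:e:] = 0 \<or> u e < w (t - [:e:])"
      using close_to_value_at_dominating_point[OF w t(2), of b] b nc unfolding e_def by (auto simp: t_def)
    have "t - [:e:] \<noteq> 0"
      using \<open>degree t \<noteq> 0\<close> by (metis degree_pCons_0 eq_iff_diff_eq_0)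
    then have te: "0 < w (t - [:e:])"
      using e \<open>w t = 0\<close> by simp
    \<comment> \<open>The factor \<open>t - e\<close> will push the value of \<open>N\<close>
      composed with \<open>t\<close> above \<open>gauss u N\<close>, whereas transcendence makes the
      two equal.\<close>
    obtain N where N: "over N" "N \<noteq> 0" "poly N e = 0"
      using ex_over_root by blast
    obtain S where S: "N = [:- e, 1:] * S"
      using poly_eq_0_iff_dvd[of N e] N(3) unfolding dvd_def by blast
    have "S \<noteq> 0"
      using N(2) S by auto
    have ge: "gauss u S \<le> w (pcompose S t)"
    proof (rule poly_val_le[OF poly_val_gauss poly_val_pcompose[OF w \<open>degree t \<noteq> 0\<close>] _ \<open>S \<noteq> 0\<close>])
      fix a
      have nz: "t - [:a:] \<noteq> 0"
        using \<open>degree t \<noteq> 0\<close> by (metis degree_pCons_0 eq_iff_diff_eq_0)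
      have "g \<le> w (t - [:a:])" if "g \<le> 0" "a = 0 \<or> g \<le> u a" for g
        using pv_diff_ge[of t g "[:a:]"] that nz \<open>w t = 0\<close> by (cases "a = 0") auto
      then have "gauss u [:- a, 1:] \<le> w (t - [:a:])"
        by (auto simp: gauss_linear)
      moreover have "pcompose [:- a, 1:] t = t - [:a:]"
        by (simp add: pcompose_pCons)
      ultimately show "gauss u [:- a, 1:] \<le> w (pcompose [:- a, 1:] t)"
        by simp
    qed
    have "pcompose S t \<noteq> 0"
      using \<open>S \<noteq> 0\<close> \<open>degree t \<noteq> 0\<close> pcompose_eq_0[of S t] by auto
    moreover have Nt: "pcompose N t = (t - [:e:]) * pcompose S t"
      unfolding S pcompose_mult by (simp add: pcompose_pCons)
    ultimately have "w (pcompose N t) = w (t - [:e:]) + w (pcompose S t)"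
      using \<open>t - [:e:] \<noteq> 0\<close> by (simp add: pv_mult)
    moreover have "gauss u N = gauss u S"
      using e \<open>w t = 0\<close> \<open>S \<noteq> 0\<close> unfolding S by (subst gauss_mult) (auto simp: gauss_linear)
    ultimately have "gauss u N < w (pcompose N t)"
      using ge te by (metis add_0 add_less_le_mono)
    moreover have "w (pcompose N t) = mono_val u \<alpha> \<delta> (pcompose N t)"
      using Nt \<open>t - [:e:] \<noteq> 0\<close> \<open>pcompose S t \<noteq> 0\<close> N(1) t(1) by (intro w_over over_pcompose) auto
    moreover have "\<dots> = gauss u N"
      by (rule mono_val_pcompose_eq_gauss[OF \<delta> \<open>degree t \<noteq> 0\<close> t(3) mt N(2)])
    ultimately show False
      by simp
  qed
  then show ?thesis
    using \<beta>(1) by blast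
qed

text \<open>A root \<open>r\<close> outside the ball has \<open>u (\<alpha> - r) < \<delta>\<close>,
  so the minimum giving the value of \<open>X - r\<close> is
  \<open>u (\<alpha> - r)\<close>.\<close>

lemma mono_val_eq_val_poly:
  assumes \<delta>: "\<delta> \<in> value_group u" and p: "p \<noteq> 0"
    and roots: "\<And>r. poly p r = 0 \<Longrightarrow> \<not> vge u \<delta> (r - \<alpha>)"
  shows "poly p \<alpha> \<noteq> 0 \<and> mono_val u \<alpha> \<delta> p = u (poly p \<alpha>)"
  using p roots
proof (induction p rule: poly_induct_linear)
  case (linear b)
  have "\<not> vge u \<delta> (b - \<alpha>)"
    using linear[of b] by simp
  then show ?case
    by (auto simp: mono_val_linear[OF \<delta>] vge_def val_minus_commute)
qed (auto simp: poly_valuation.pv_mult[OF poly_valuation_mono_val[OF \<delta>]]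
    poly_valuation.pv_const[OF poly_valuation_mono_val[OF \<delta>]] val_mult)

text \<open>The factor \<open>X - \<beta>\<close> has values \<open>\<delta>\<close> and
  \<open>\<gamma>\<close>, while the value of the cofactor cannot drop as the radius grows.\<close>

lemma mono_val_strict:
  assumes "\<delta> \<in> value_group u" "\<gamma> \<in> value_group u" "\<delta> < \<gamma>" "p \<noteq> 0" "poly p \<beta> = 0"
  shows "mono_val u \<beta> \<delta> p < mono_val u \<beta> \<gamma> p"
proof -
  interpret d: poly_valuation u "mono_val u \<beta> \<delta>"
    by (rule poly_valuation_mono_val) fact
  interpret g: poly_valuation u "mono_val u \<beta> \<gamma>"
    by (rule poly_valuation_mono_val) fact
  obtain q where q: "p = [:- \<beta>, 1:] * q"
    using assms(5) poly_eq_0_iff_dvd[of p \<beta>] unfolding dvd_def by blast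
  have "q \<noteq> 0"
    using assms(4) q by auto
  have "mono_val u \<beta> \<delta> q \<le> mono_val u \<beta> \<gamma> q"
    by (rule poly_val_le[OF d.poly_val g.poly_val _ \<open>q \<noteq> 0\<close>])
      (use assms(3) in \<open>auto simp: mono_val_linear[OF assms(1)] mono_val_linear[OF assms(2)] min_le_iff_disj\<close>)
  then show ?thesis
    unfolding q using \<open>q \<noteq> 0\<close> assms(3)
    by (simp only: d.pv_mult g.pv_mult pCons_eq_0_iff one_neq_zero simp_thms not_False_eq_True
        mono_val_linear[OF assms(1)] mono_val_linear[OF assms(2)] if_True)
      (rule add_less_le_mono)
qed

text \<open>Minimality of \<open>\<alpha>\<close> in its ball makes the monomial valuation of a polynomial over \<open>K\<close> of smaller
  degree equal to the value at \<open>\<alpha>\<close>; the same then holds at \<open>\<beta>\<close>, so \<open>\<alpha> \<mapsto> \<beta>\<close> preserves values.\<close>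

lemma minimal_centre_conjugate:
  assumes \<delta>: "\<delta> \<in> value_group u" and \<gamma>: "\<gamma> \<in> value_group u"
    and f: "over f" "f \<noteq> 0" "poly f \<alpha> = 0" "poly f \<beta> = 0"
    and min: "\<And>b p. vge u \<delta> (b - \<alpha>) \<Longrightarrow> over p \<Longrightarrow> p \<noteq> 0 \<Longrightarrow> poly p b = 0 \<Longrightarrow> degree f \<le> degree p"
    and eq: "\<And>p. over p \<Longrightarrow> p \<noteq> 0 \<Longrightarrow> mono_val u \<beta> \<gamma> p = mono_val u \<alpha> \<delta> p"
  shows "\<gamma> = \<delta> \<and> (\<exists>\<sigma>\<in>decomp_group K u. \<sigma> \<alpha> = \<beta>)"
proof -
  \<comment> \<open>Minimality carries over to the ball around \<open>\<beta>\<close>: with the two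
    monomial valuations exchanged, \<open>ex_maximal_root\<close> replaces the root \<open>b\<close>
    of \<open>p\<close> near \<open>\<beta>\<close> by a root near \<open>\<alpha>\<close>.\<close>
  have min': "degree f \<le> degree p"
    if b: "vge u \<gamma> (b - \<beta>)" and p: "over p" "p \<noteq> 0" "poly p b = 0" for b p
  proof -
    have "mono_val u \<alpha> \<delta> q = mono_val u b \<gamma> q" if "over q" "q \<noteq> 0" for q
      using eq that mono_val_ball[OF \<gamma> b] by simp
    then obtain a where a: "poly p a = 0" "\<And>x. mono_val u \<alpha> \<delta> [:- x, 1:] \<le> mono_val u \<alpha> \<delta> [:- a, 1:]"
      using ex_maximal_root[OF \<gamma> poly_val_mono_val[OF \<delta>] _ p] by blast
    then have "vge u \<delta> (a - \<alpha>)"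
      using a(2)[of \<alpha>] by (auto simp: mono_val_linear[OF \<delta>] vge_def val_minus_commute split: if_splits)
    then show ?thesis
      using min p a(1) by blast
  qed
  have small: "poly p \<alpha> \<noteq> 0 \<and> poly p \<beta> \<noteq> 0 \<and> u (poly p \<alpha>) = u (poly p \<beta>)"
    if p: "over p" "p \<noteq> 0" "degree p < degree f" for p
  proof -
    have "poly p \<alpha> \<noteq> 0 \<and> mono_val u \<alpha> \<delta> p = u (poly p \<alpha>)"
      by (rule mono_val_eq_val_poly[OF \<delta> p(2)]) (use min[OF _ p(1,2)] p(3) in \<open>meson leD\<close>)
    moreover have "poly p \<beta> \<noteq> 0 \<and> mono_val u \<beta> \<gamma> p = u (poly p \<beta>)"
      by (rule mono_val_eq_val_poly[OF \<gamma> p(2)]) (use min'[OF _ p(1,2)] p(3) in \<open>meson leD\<close>)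
    ultimately show ?thesis
      using eq p by simp
  qed
  interpret KG: field_graph "Id_on K"
    by (rule field_graph_diag)
  have all: "(poly p \<alpha> = 0 \<longleftrightarrow> poly p \<beta> = 0) \<and> (poly p \<alpha> \<noteq> 0 \<longrightarrow> u (poly p \<alpha>) = u (poly p \<beta>))"
    if p: "over p" for p
  proof -
    obtain s r where sr: "over r" "p = f * s + r" "r = 0 \<or> degree r < degree f"
      using KG.polyrel_division[of f f p p] f p unfolding polyrel_diag by blast
    then have "poly p \<alpha> = poly r \<alpha>" "poly p \<beta> = poly r \<beta>"
      using f by simp_all
    then show ?thesis
      using small[of r] sr by (cases "r = 0") auto
  qed
  have "ring_graph (adjoin (Id_on K) \<alpha> \<beta>)"
    by (rule KG.ring_graph_adjoin) (use all in \<open>auto simp: polyrel_diag\<close>)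
  moreover have "valued u (adjoin (Id_on K) \<alpha> \<beta>)"
    using all unfolding valued_def adjoin_def polyrel_diag by blast
  ultimately obtain \<sigma> where \<sigma>: "\<sigma> \<in> decomp_group K u" "\<forall>(x, y)\<in>adjoin (Id_on K) \<alpha> \<beta>. \<sigma> x = y"
    using extend_to_decomp_group[OF _ KG.subset_adjoin] by blast
  have \<sigma>\<alpha>: "\<sigma> \<alpha> = \<beta>"
    using bspec[OF \<sigma>(2) KG.adjoin_self] by simp
  \<comment> \<open>\<open>\<sigma>\<close> fixes \<open>f\<close>, so moving the centre from
    \<open>\<alpha>\<close> to \<open>\<beta>\<close> keeps its value at radius
    \<open>\<delta>\<close>; strict monotonicity at the root \<open>\<beta>\<close> then forces
    equal radii.\<close>
  have "mono_val u \<beta> \<delta> f = mono_val u \<alpha> \<delta> f"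
    using mono_val_map_poly[OF \<sigma>(1) \<delta> f(2), of \<alpha>] map_poly_gal(4)[OF decomp_group_gal[OF \<sigma>(1)] f(1)] \<sigma>\<alpha>
    by simp
  then have "mono_val u \<beta> \<delta> f = mono_val u \<beta> \<gamma> f"
    using eq f by simp
  then have "\<gamma> = \<delta>"
    using mono_val_strict[OF \<delta> \<gamma> _ f(2,4)] mono_val_strict[OF \<gamma> \<delta> _ f(2,4)]
    by (metis less_irrefl linorder_neqE)
  then show ?thesis
    using \<sigma>(1) \<sigma>\<alpha> by blast
qed

text \<open>The centre is first moved to a point \<open>a\<close> of the ball with least degree over
  \<open>K\<close>, as \<open>minimal_centre_conjugate\<close> requires; \<open>\<sigma>\<close>
  then carries the ball of \<open>a\<close>, which is that of \<open>\<alpha>\<close>, to the ball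
  of \<open>\<sigma> \<alpha>\<close>.\<close>

lemma conjugate_mono_val:
  assumes \<delta>: "\<delta> \<in> value_group u" and w: "poly_val u w"
    and vals: "\<And>p. p \<noteq> 0 \<Longrightarrow> \<exists>c. c \<noteq> 0 \<and> w p = u c"
    and w_over: "\<And>p. over p \<Longrightarrow> p \<noteq> 0 \<Longrightarrow> w p = mono_val u \<alpha> \<delta> p"
  shows "\<exists>\<sigma>\<in>decomp_group K u. ring_of w = U_ad u (\<sigma> \<alpha>) \<delta>"
proof -
  let ?P = "\<lambda>f. over f \<and> f \<noteq> 0 \<and> (\<exists>a. vge u \<delta> (a - \<alpha>) \<and> poly f a = 0)"
  obtain f0 where "?P f0"
    using ex_over_root[of \<alpha>] vge_0 by (metis diff_self)
  then obtain f where f: "?P f" and least: "\<And>p. ?P p \<Longrightarrow> degree f \<le> degree p"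
    using ex_has_least_nat[of ?P f0 degree] by blast
  then obtain a where a: "vge u \<delta> (a - \<alpha>)" "poly f a = 0"
    by blast
  have w_a: "w p = mono_val u a \<delta> p" if "over p" "p \<noteq> 0" for p
    using w_over that mono_val_ball[OF \<delta> a(1)] by simp
  obtain \<beta> where \<beta>: "poly f \<beta> = 0" "\<And>b. w [:- b, 1:] \<le> w [:- \<beta>, 1:]"
    using ex_maximal_root[OF \<delta> w w_a] f a(2) by blast
  define \<gamma> where "\<gamma> = w [:- \<beta>, 1:]"
  have \<gamma>: "\<gamma> \<in> value_group u"
    using vals[of "[:- \<beta>, 1:]"] by (auto simp: \<gamma>_def value_group_def)
  have w_eq: "w p = mono_val u \<beta> \<gamma> p" if "p \<noteq> 0" for p
    using mono_val_eqI[OF w _ \<beta>(2) that] \<gamma> unfolding \<gamma>_def by blast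
  have "\<gamma> = \<delta> \<and> (\<exists>\<sigma>\<in>decomp_group K u. \<sigma> a = \<beta>)"
  proof (rule minimal_centre_conjugate[OF \<delta> \<gamma> _ _ a(2) \<beta>(1)])
    fix b p assume "vge u \<delta> (b - a)" "over p" "p \<noteq> 0" "poly p b = 0"
    then show "degree f \<le> degree p"
      using least ball_trans a(1) by blast
  qed (use f w_eq w_a in auto)
  then obtain \<sigma> where \<sigma>: "\<gamma> = \<delta>" "\<sigma> \<in> decomp_group K u" "\<sigma> a = \<beta>"
    by blast
  note g = decomp_group_gal[OF \<sigma>(2)]
  have "vge u \<delta> (\<sigma> (a - \<alpha>))"
    using a(1) decomp_group_val[OF \<sigma>(2), of "a - \<alpha>"] gal_0[OF g] unfolding vge_def by metis
  then have "vge u \<delta> (\<beta> - \<sigma> \<alpha>)"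
    by (simp add: gal_hom(5)[OF g] \<sigma>(3))
  then have "U_ad u \<beta> \<delta> = U_ad u (\<sigma> \<alpha>) \<delta>"
    using U_ad_eq_iff[OF \<delta> \<delta>] by blast
  moreover have "ring_of w = U_ad u \<beta> \<delta>"
    unfolding U_ad_eq_ring_of using w_eq \<sigma>(1) by (intro ring_of_cong) simp
  ultimately show ?thesis
    using \<sigma>(2) by blast
qed

theorem extensions_conjugate:
  assumes "\<delta> \<in> value_group u" "is_valuation_domain R"
    and "R \<inter> ratfun_over K = U_ad u \<alpha> \<delta> \<inter> ratfun_over K" "{c. const_fr c \<in> R} = val_ring u"
  shows "\<exists>\<sigma>\<in>decomp_group K u. R = U_ad u (\<sigma> \<alpha>) \<delta>"
proof -
  interpret extension K u R \<alpha> \<delta>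
    by unfold_locales (fact assms)+
  show ?thesis
    using ex_poly_val conjugate_mono_val[OF assms(1)] by metis
qed

lemma U_ad_is_extension:
  assumes "\<delta> \<in> value_group u"
  shows "is_valuation_domain (U_ad u \<alpha> \<delta>)" "{c. const_fr c \<in> U_ad u \<alpha> \<delta>} = val_ring u"
  unfolding U_ad_eq_ring_of
  using poly_valuation.is_valuation_domain_ring_of[OF poly_valuation_mono_val[OF assms]]
    poly_valuation.const_fr_in_ring_of[OF poly_valuation_mono_val[OF assms]] by auto

end

theorem mainTheorem1:
  fixes K :: "'k::field set" and u :: "'k \<Rightarrow> 'g::linordered_ab_group_add"
    and \<alpha> \<alpha>' :: 'k and \<delta> \<delta>' :: 'g
  assumes "is_subfield K"
    and "alg_closed_type TYPE('k)"
    and "algebraic_over K"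
    and "is_valuation u"
    and "\<delta> \<in> value_group u" and "\<delta>' \<in> value_group u"
  shows "((U_ad u \<alpha> \<delta> \<inter> ratfun_over K = U_ad u \<alpha>' \<delta>' \<inter> ratfun_over K)
            \<longleftrightarrow> (\<exists>\<sigma>\<in>decomp_group K u. gal_img \<sigma> (U_ad u \<alpha> \<delta>) = U_ad u \<alpha>' \<delta>'))
       \<and> ((\<exists>\<sigma>\<in>decomp_group K u. gal_img \<sigma> (U_ad u \<alpha> \<delta>) = U_ad u \<alpha>' \<delta>')
            \<longleftrightarrow> (\<delta> = \<delta>' \<and> (\<exists>\<sigma>\<in>decomp_group K u. \<sigma> \<alpha> = \<alpha>' \<or> \<delta> \<le> u (\<sigma> \<alpha> - \<alpha>'))))
       \<and> {R. is_valuation_domain R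
              \<and> R \<inter> ratfun_over K = U_ad u \<alpha> \<delta> \<inter> ratfun_over K
              \<and> {c. const_fr c \<in> R} = val_ring u}
         = {U_ad u (\<sigma> \<alpha>) \<delta> | \<sigma>. \<sigma> \<in> decomp_group K u}"
proof (intro conjI)
  interpret valued_closure K u
    by unfold_locales (fact assms)+
  note \<delta> = assms(5) and \<delta>' = assms(6)
  show "(U_ad u \<alpha> \<delta> \<inter> ratfun_over K = U_ad u \<alpha>' \<delta>' \<inter> ratfun_over K) \<longleftrightarrow>
      (\<exists>\<sigma>\<in>decomp_group K u. gal_img \<sigma> (U_ad u \<alpha> \<delta>) = U_ad u \<alpha>' \<delta>')" (is "?restr \<longleftrightarrow> ?conj")
  proof
    assume ?restr
    \<comment> \<open>\<open>U_ad u \<alpha>' \<delta>'\<close> is itself an extension of the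
      restricted ring, so conjugacy of the extensions applies to it.\<close>
    then have "\<exists>\<sigma>\<in>decomp_group K u. U_ad u \<alpha>' \<delta>' = U_ad u (\<sigma> \<alpha>) \<delta>"
      by (intro extensions_conjugate[OF \<delta>] U_ad_is_extension[OF \<delta>']) simp
    then show ?conj
      using gal_img_U_ad[OF _ \<delta>] by metis
  next
    assume ?conj
    then show ?restr
      using gal_img_U_ad[OF _ \<delta>] U_ad_Int_ratfun_over[OF _ \<delta>] by metis
  qed
  \<comment> \<open>Conjugation only moves the centre to \<open>\<sigma> \<alpha>\<close>, so this
    is equality of two monomial rings; the disjunct \<open>\<sigma> \<alpha> = \<alpha>'\<close>
    reads \<open>u 0\<close> as infinity.\<close>
  show "?conj \<longleftrightarrow> (\<delta> = \<delta>' \<and> (\<exists>\<sigma>\<in>decomp_group K u. \<sigma> \<alpha> = \<alpha>' \<or> \<delta> \<le> u (\<sigma> \<alpha> - \<alpha>')))"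
    using gal_img_U_ad[OF _ \<delta>] U_ad_eq_iff[OF \<delta> \<delta>'] by (auto simp: vge_def)
  show "{R. is_valuation_domain R
              \<and> R \<inter> ratfun_over K = U_ad u \<alpha> \<delta> \<inter> ratfun_over K
              \<and> {c. const_fr c \<in> R} = val_ring u}
         = {U_ad u (\<sigma> \<alpha>) \<delta> | \<sigma>. \<sigma> \<in> decomp_group K u}" (is "?L = ?R")
  proof
    show "?L \<subseteq> ?R"
      using extensions_conjugate[OF \<delta>] by blast
    show "?R \<subseteq> ?L"
      using U_ad_is_extension[OF \<delta>] U_ad_Int_ratfun_over[OF _ \<delta>] by blast
  qed
qed

end
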